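(* Assume that $X_0\in L^\infty$. Then for every $\beta\in\mathbb{R}$ and $\lambda>0$, the dual optimization problem $\max_{w\in\mathscr{W}^\mathrm{icx}}\inf_{Q\in\mathscr{Q}}L(Q,w;\beta,\lambda)$ has a unique solution $w^*_{\beta,\lambda}$, which satisfies $$(w^*_{\beta,\lambda})^\prime(s)=\left(-\widehat H_{\beta,\lambda}^\prime(s)\right)^+,\quad s\in[0,1),$$ where $H_{\beta,\lambda}(s)=\int_0^s(2\beta-\lambda Q_\rho(1-t)-2Q_0(t))dt$ for $s\in[0,1]$ and $\widehat H_{\beta,\lambda}$ is the concave envelope of $H_{\beta,\lambda}$. Moreover, $(w^*_{\beta,\lambda})^\prime$ is bounded and $w^*_{\beta,\lambda}\in\mathscr{W}^\mathrm{icx}_{c,2}$.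
   Context: Setting: complete nonatomic probability space; $\rho\in L^2$ is the stochastic discount factor with $\rho>0$ a.s. and $\mathrm{Var}[\rho]>0$; $Q_X$ is the upper quantile function of $X$, $Q_0=Q_{X_0}$. $\mathscr{Q}$ is the set of increasing right-continuous $Q:[0,1)\to\mathbb{R}$ with $\int_0^1Q^2<\infty$. $\mathscr{W}^\mathrm{icx}$ is the set of increasing convex $w:[0,1]\to[0,\infty)$ with $w(0)=0$ (viewed as measures on $[0,1]$); $\mathscr{W}^\mathrm{icx}_{c,2}$ is the subset of those $w$ that are continuous on $[0,1]$ with $w'\in L^2([0,1))$. For $Q\in\mathscr{Q}$, $w\in\mathscr{W}^\mathrm{icx}$, $$L(Q,w;\beta,\lambda)=\int_0^1(Q(s)-\beta)^2ds+\lambda\int_0^1Q(s)Q_\rho(1-s)ds-\Big(\int_{[0,1]}Q\,dw-\int_{[0,1]}Q_0\,dw\Big).$$ The concave envelope $\widehat H$ of $H$ is the smallest concave function on $[0,1]$ dominating $H$; primes denote right derivatives. *)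

theory Defs
  imports "HOL-Analysis.Analysis" "HOL-Probability.Probability"
begin

definition nonatomic :: "'a measure \<Rightarrow> bool" where
  "nonatomic M \<longleftrightarrow> (\<forall>A\<in>sets M. measure M A > 0 \<longrightarrow>
      (\<exists>B\<in>sets M. B \<subseteq> A \<and> 0 < measure M B \<and> measure M B < measure M A))"

definition upper_quantile :: "'a measure \<Rightarrow> ('a \<Rightarrow> real) \<Rightarrow> real \<Rightarrow> real" where
  "upper_quantile M X s = Inf {x. measure M {\<omega>\<in>space M. X \<omega> \<le> x} > s}"

definition Qset :: "(real \<Rightarrow> real) set" where
  "Qset = {Q. mono_on {0..<1} Q \<and> (\<forall>s\<in>{0..<1}. continuous (at_right s) Q)
              \<and> set_integrable lborel {0..<1} (\<lambda>s. (Q s)\<^sup>2)}"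

definition Wicx :: "(real \<Rightarrow> real) set" where
  "Wicx = {w. mono_on {0..1} w \<and> convex_on {0..1} w \<and> (\<forall>s\<in>{0..1}. 0 \<le> w s) \<and> w 0 = 0}"

definition rderiv :: "(real \<Rightarrow> real) \<Rightarrow> real \<Rightarrow> real" where
  "rderiv f s = (THE d. (f has_real_derivative d) (at_right s))"

definition Wc2 :: "(real \<Rightarrow> real) set" where
  "Wc2 = {w. w \<in> Wicx \<and> continuous_on {0..1} w
             \<and> set_integrable lborel {0..<1} (\<lambda>s. (rderiv w s)\<^sup>2)}"

text \<open>The Lebesgue--Stieltjes measure dw on [0,1] induced by w (no mass left of 0,
  an atom w(1) - w(1-) at 1).\<close>
definition stieltjes :: "(real \<Rightarrow> real) \<Rightarrow> real measure" where
  "stieltjes w = interval_measure (\<lambda>x. w (max 0 (min 1 x)))"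

text \<open>Extension of Q to [0,1] by its left limit at 1 (possibly +infinity).\<close>
definition Qbar :: "(real \<Rightarrow> real) \<Rightarrow> real \<Rightarrow> ereal" where
  "Qbar Q x = (if x < 1 then ereal (Q x) else (SUP s\<in>{0..<1}. ereal (Q s)))"

definition int_dw :: "(real \<Rightarrow> real) \<Rightarrow> (real \<Rightarrow> real) \<Rightarrow> ereal" where
  "int_dw Q w =
     enn2ereal (\<integral>\<^sup>+ x. e2ennreal (Qbar Q x) * indicator {0..1} x \<partial>stieltjes w)
   - enn2ereal (\<integral>\<^sup>+ x. e2ennreal (- Qbar Q x) * indicator {0..1} x \<partial>stieltjes w)"

text \<open>The Lagrangian L(Q,w;beta,lambda); Qrho and Q0 are the quantile functions of rho and X0.\<close>
definition Lagr :: "(real \<Rightarrow> real) \<Rightarrow> (real \<Rightarrow> real) \<Rightarrow> (real \<Rightarrow> real) \<Rightarrow> (real \<Rightarrow> real)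
                    \<Rightarrow> real \<Rightarrow> real \<Rightarrow> ereal" where
  "Lagr Qrho Q0 Q w \<beta> lam =
     ereal ((LINT s:{0..<1}|lborel. (Q s - \<beta>)\<^sup>2)
            + lam * (LINT s:{0..<1}|lborel. Q s * Qrho (1 - s)))
     - (int_dw Q w - int_dw Q0 w)"

definition dual_obj :: "(real \<Rightarrow> real) \<Rightarrow> (real \<Rightarrow> real) \<Rightarrow> (real \<Rightarrow> real) \<Rightarrow> real \<Rightarrow> real \<Rightarrow> ereal" where
  "dual_obj Qrho Q0 w \<beta> lam = (INF Q\<in>Qset. Lagr Qrho Q0 Q w \<beta> lam)"

definition concave_envelope :: "(real \<Rightarrow> real) \<Rightarrow> real \<Rightarrow> real" where
  "concave_envelope H s =
     Inf {g s | g. concave_on {0..1} g \<and> (\<forall>t\<in>{0..1}. H t \<le> g t)}"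

definition Hfun :: "(real \<Rightarrow> real) \<Rightarrow> (real \<Rightarrow> real) \<Rightarrow> real \<Rightarrow> real \<Rightarrow> real \<Rightarrow> real" where
  "Hfun Qrho Q0 \<beta> lam s = (LINT t:{0..s}|lborel. 2 * \<beta> - lam * Qrho (1 - t) - 2 * Q0 t)"

end

theory Submission
  imports Defs
begin

text \<open>Write \<open>a s = \<beta> - lam * Q\<^sub>\<rho>(1 - s) / 2\<close> and \<open>h = 2 * a - 2 * Q\<^sub>0\<close>, so that \<open>H' = h\<close>. Completing the square in
  \<open>Q\<close> shows that for a continuous \<open>w\<close> with square integrable derivative the dual objective is a constant
  minus \<open>\<parallel>w' + h\<parallel>\<^sup>2 / 4\<close> (the pointwise minimiser \<open>a + w' / 2\<close> is increasing, but may be unbounded near 0 and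
  then has to be truncated), while test functions \<open>k * 1\<^bsub>[s,1)\<^esub>\<close> and \<open>min(w', n) / 2\<close> show that it is
  \<open>-\<infinity>\<close> for all other \<open>w\<close>. The dual problem is thus the projection of \<open>-h\<close> onto the cone of nonnegative
  increasing functions. That \<open>\<phi> = (- E')\<^sup>+\<close>, where \<open>E\<close> is the concave envelope of \<open>H\<close>, is this projection
  means that \<open>\<phi> + h\<close> is orthogonal to \<open>\<phi>\<close> and has nonnegative integral over every \<open>[s, 1]\<close>: the latter
  follows from \<open>E \<ge> H\<close> and \<open>E(1) = H(1)\<close>, the former from \<open>E\<close> being affine where \<open>E > H\<close>.\<close>

section \<open>Convex functions and their right derivatives\<close>

text \<open>The difficulties sit at the two ends of the interval. Near 0 the function
  \<open>h\<close> may tend to minus infinity, since \<rho> is only square integrable, so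
  \<open>H\<close> need not be Lipschitz. Its envelope is: the slopes of a concave function are
  extreme at the ends, and through each end point of the graph of \<open>H\<close> there is a line
  above it. For \<open>H\<close> itself a continuous modulus \<open>B\<close> replaces the Lipschitz
  bound. Near 1 a competitor may have a jump or an unbounded derivative, so its derivative is
  integrated over \<open>{a..b}\<close> with \<open>b < 1\<close> only, and its continuity at 1 has
  to be derived from a lower bound on its dual value. Every competitor is compared with one number,
  \<open>J \<phi>\<close>, the integral of the pointwise minima of the Lagrangian. The candidate
  reaches it, and a competitor that reaches it must be the candidate. Existence and uniqueness thus
  come together, without a compactness argument.\<close>

text \<open>On a fine partition uniform continuity makes each increment of \<open>B\<close> smaller
  than \<open>e\<close>, while the increments of \<open>A\<close> telescope. As \<open>A\<close> may
  jump, this gives identities for monotone functions that differentiation would not reach.\<close>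

lemma const_if_increment_bound:
  fixes D A B :: "real \<Rightarrow> real"
  assumes ab: "a \<le> b" and A: "mono_on {a..b} A" and B: "continuous_on {a..b} B"
    and inc: "\<And>x y. a \<le> x \<Longrightarrow> x \<le> y \<Longrightarrow> y \<le> b \<Longrightarrow> \<bar>D y - D x\<bar> \<le> (A y - A x) * \<bar>B y - B x\<bar>"
  shows "D b = D a"
proof -
  have le: "\<bar>D b - D a\<bar> \<le> e * (A b - A a)" if e: "e > 0" for e
  proof -
    have "uniformly_continuous_on {a..b} B"
      by (rule compact_uniformly_continuous) (use B in auto)
    then obtain d where d: "d > 0"
      "\<And>x y. x \<in> {a..b} \<Longrightarrow> y \<in> {a..b} \<Longrightarrow> dist y x < d \<Longrightarrow> dist (B y) (B x) < e"
      unfolding uniformly_continuous_on_def using e by metis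
    obtain n where n: "(b - a) / d < real n" using reals_Archimedean2 by blast
    define m where "m = Suc n"
    have m: "m > 0" "(b - a) / real m < d"
    proof -
      have "b - a < d * real n" using n d by (simp add: field_simps)
      also have "\<dots> < d * real m" using d by (simp add: m_def)
      finally show "(b - a) / real m < d" by (simp add: m_def field_simps)
    qed (simp add: m_def)
    define t where "t i = a + real i * ((b - a) / real m)" for i
    have t0: "t 0 = a" and tm: "t m = b" using m(1) by (auto simp: t_def)
    have tS: "t (Suc i) = t i + (b - a) / real m" for i unfolding t_def of_nat_Suc by (simp only: distrib_right mult_1)
    have tmono: "t i \<le> t j" if "i \<le> j" for i j
      unfolding t_def using that ab m(1) by (intro add_left_mono mult_right_mono) auto
    have tin: "t i \<in> {a..b}" if "i \<le> m" for i
      using tmono[of 0 i] tmono[of i m] that t0 tm by auto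
    have step: "\<bar>D (t (Suc i)) - D (t i)\<bar> \<le> e * (A (t (Suc i)) - A (t i))" if "i < m" for i
    proof -
      have 1: "t i \<in> {a..b}" "t (Suc i) \<in> {a..b}" using tin that by auto
      have "dist (t (Suc i)) (t i) < d" using m(2) ab by (simp add: tS dist_real_def)
      then have "\<bar>B (t (Suc i)) - B (t i)\<bar> < e" using d(2)[OF 1] by (simp add: dist_real_def)
      moreover have "A (t i) \<le> A (t (Suc i))" using A 1 tmono[of i "Suc i"] by (auto simp: mono_on_def)
      moreover have "\<bar>D (t (Suc i)) - D (t i)\<bar> \<le> (A (t (Suc i)) - A (t i)) * \<bar>B (t (Suc i)) - B (t i)\<bar>"
        using inc[of "t i" "t (Suc i)"] 1 tmono[of i "Suc i"] by auto
      ultimately show ?thesis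
        by (smt (verit) mult.commute mult_left_mono)
    qed
    have "\<bar>D (t k) - D (t 0)\<bar> \<le> e * (A (t k) - A (t 0))" if "k \<le> m" for k
      using that
    proof (induction k)
      case (Suc k)
      then show ?case using step[of k] by (auto simp: algebra_simps)
    qed simp
    from this[of m] show ?thesis by (simp add: t0 tm)
  qed
  have "\<bar>D b - D a\<bar> \<le> 0"
  proof (rule field_le_epsilon)
    fix e :: real assume e: "e > 0"
    have AA: "A a \<le> A b" using A ab by (auto simp: mono_on_def)
    \<comment> \<open>The added 1 keeps the denominator positive when
      \<open>A b = A a\<close>.\<close>
    have "e / (A b - A a + 1) * (A b - A a) \<le> e"
      using e AA by (simp add: field_simps)
    then show "\<bar>D b - D a\<bar> \<le> 0 + e"
      using le[of "e / (A b - A a + 1)"] e AA by (smt (verit) divide_pos_pos)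
  qed
  then show ?thesis by simp
qed

text \<open>Over \<open>{x..y}\<close> the increment of \<open>f\<close> differs from the integral
  of \<open>p\<close> by at most \<open>(p y - p x) * (y - x)\<close>, a product to which
  \<open>const_if_increment_bound\<close> applies. With slopes for \<open>p\<close> this recovers a
  convex function from its one-sided derivative.\<close>

lemma integral_eq_if_sandwich:
  fixes f p :: "real \<Rightarrow> real"
  assumes ab: "a \<le> b" and p: "mono_on {a..b} p"
    and lo: "\<And>x y. a \<le> x \<Longrightarrow> x < y \<Longrightarrow> y \<le> b \<Longrightarrow> p x * (y - x) \<le> f y - f x"
    and hi: "\<And>x y. a \<le> x \<Longrightarrow> x < y \<Longrightarrow> y \<le> b \<Longrightarrow> f y - f x \<le> p y * (y - x)"
  shows "(p has_integral f b - f a) {a..b}"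
proof -
  have int: "p integrable_on {x..y}" if "a \<le> x" "y \<le> b" for x y
    by (rule integrable_on_mono_on) (use p that in \<open>auto simp: mono_on_def\<close>)
  define D where "D x = f x - integral {a..x} p" for x
  have "D b = D a"
  proof (rule const_if_increment_bound[where D = D and a = a and b = b and A = p and B = "\<lambda>x. x"])
    fix x y assume xy: "a \<le> x" "x \<le> y" "y \<le> b"
    show "\<bar>D y - D x\<bar> \<le> (p y - p x) * \<bar>y - x\<bar>"
    proof (cases "x = y")
      case False
      then have xy': "x < y" using xy by simp
      have "integral {a..x} p + integral {x..y} p = integral {a..y} p"
        by (rule Henstock_Kurzweil_Integration.integral_combine) (use xy int in auto)
      then have eq: "D y - D x = f y - f x - integral {x..y} p" by (simp add: D_def)
      have c: "(\<lambda>_. c) integrable_on {x..y}" for c :: real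
        by (rule integrable_const_ivl)
      have pxy: "p x \<le> p t" "p t \<le> p y" if "t \<in> {x..y}" for t
        using that xy mono_onD[OF p, of x t] mono_onD[OF p, of t y] by auto
      have "integral {x..y} (\<lambda>_. p x) \<le> integral {x..y} p"
        by (rule integral_le[OF c int]) (use xy pxy in auto)
      moreover have "integral {x..y} p \<le> integral {x..y} (\<lambda>_. p y)"
        by (rule integral_le[OF int c]) (use xy pxy in auto)
      ultimately have "p x * (y - x) \<le> integral {x..y} p" "integral {x..y} p \<le> p y * (y - x)"
        using xy by (simp_all add: mult.commute)
      then show ?thesis
        using eq lo[OF xy(1) xy' xy(3)] hi[OF xy(1) xy' xy(3)] xy' by (simp add: algebra_simps abs_le_iff)
    qed simp
  qed (use ab p in auto)
  then have "integral {a..b} p = f b - f a" by (simp add: D_def)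
  then show ?thesis using int[of a b] by (simp add: has_integral_iff)
qed

text \<open>For convex \<open>f\<close> the slopes decrease as \<open>y\<close> falls to
  \<open>x\<close>, so this infimum is the right derivative. Unlike a limit it can be handled by
  order arguments alone.\<close>

definition right_slope :: "(real \<Rightarrow> real) \<Rightarrow> real \<Rightarrow> real" where
  "right_slope f x = (INF y\<in>{x<..1}. (f y - f x) / (y - x))"

lemma convex_on_slope_mono:
  fixes f :: "real \<Rightarrow> real"
  assumes f: "convex_on {a..b} f" and "a \<le> x" "x < t" "t < y" "y \<le> b"
  shows "(f t - f x) / (t - x) \<le> (f y - f x) / (y - x)"
    and "(f y - f x) / (y - x) \<le> (f y - f t) / (y - t)"
proof -
  have "(f x - f t) / (x - t) \<le> (f x - f y) / (x - y)" "(f x - f y) / (x - y) \<le> (f t - f y) / (t - y)"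
    using convex_on_slope_le[OF f, of x y t] assms by auto
  moreover have "(f u - f v) / (u - v) = (f v - f u) / (v - u)" for u v
    by (metis minus_diff_eq minus_divide_divide)
  ultimately show "(f t - f x) / (t - x) \<le> (f y - f x) / (y - x)"
    "(f y - f x) / (y - x) \<le> (f y - f t) / (y - t)" by metis+
qed

text \<open>The bound \<open>L\<close> keeps the slopes at 0 from tending to minus infinity. Nothing
  bounds them from above, so \<open>f\<close> may still jump at 1. The instances are the negated
  envelope and, with \<open>L = 0\<close>, the members of \<open>Wicx\<close>.\<close>

locale convex_lower_lipschitz =
  fixes f :: "real \<Rightarrow> real" and L :: real
  assumes conv: "convex_on {0..1} f"
    and lower: "\<And>x y. 0 \<le> x \<Longrightarrow> x < y \<Longrightarrow> y \<le> 1 \<Longrightarrow> L * (y - x) \<le> f y - f x"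
begin

abbreviation "sl x y \<equiv> (f y - f x) / (y - x)"

lemma slope_ge: "0 \<le> x \<Longrightarrow> x < y \<Longrightarrow> y \<le> 1 \<Longrightarrow> L \<le> sl x y"
  using lower[of x y] by (simp add: field_simps)

lemma bdd_slopes: "0 \<le> x \<Longrightarrow> bdd_below ((\<lambda>y. sl x y) ` {x<..1})"
  by (rule bdd_belowI[of _ L]) (use slope_ge in auto)

lemma right_slope_le_slope: "0 \<le> x \<Longrightarrow> x < y \<Longrightarrow> y \<le> 1 \<Longrightarrow> right_slope f x \<le> sl x y"
  unfolding right_slope_def by (rule cINF_lower[OF bdd_slopes]) auto

lemma right_slope_lower: "0 \<le> x \<Longrightarrow> x < y \<Longrightarrow> y \<le> 1 \<Longrightarrow> right_slope f x * (y - x) \<le> f y - f x"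
  using right_slope_le_slope[of x y] by (simp add: field_simps)

lemma right_slope_ge: "0 \<le> x \<Longrightarrow> x < 1 \<Longrightarrow> L \<le> right_slope f x"
  unfolding right_slope_def by (rule cINF_greatest) (use slope_ge in auto)

lemma right_slope_upper:
  assumes "0 \<le> x" "x < y" "y < 1"
  shows "f y - f x \<le> right_slope f y * (y - x)"
proof -
  have "sl x y \<le> right_slope f y"
    unfolding right_slope_def
  proof (rule cINF_greatest)
    fix z assume z: "z \<in> {y<..1}"
    then show "sl x y \<le> sl y z"
      using convex_on_slope_mono[OF conv, of x y z] assms by auto
  qed (use assms in auto)
  then show ?thesis using assms by (simp add: field_simps)
qed

lemma right_slope_mono: "mono_on {0..<1} (right_slope f)"
proof (rule mono_onI)
  fix x y :: real assume xy: "x \<in> {0..<1}" "y \<in> {0..<1}" "x \<le> y"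
  show "right_slope f x \<le> right_slope f y"
  proof (cases "x = y")
    case False
    then have "right_slope f x * (y - x) \<le> f y - f x" "f y - f x \<le> right_slope f y * (y - x)"
      using xy by (simp_all add: right_slope_lower right_slope_upper)
    then have "right_slope f x * (y - x) \<le> right_slope f y * (y - x)" by (rule order_trans)
    moreover have "y - x > 0" using False xy by auto
    ultimately show ?thesis by (rule mult_right_le_imp_le)
  qed simp
qed

lemma slope_near:
  assumes "0 \<le> x" "x < 1" "e > 0"
  obtains z where "x < z" "z \<le> 1" "sl x z < right_slope f x + e"
proof -
  have "right_slope f x < right_slope f x + e" using assms by simp
  then have "\<exists>z\<in>{x<..1}. sl x z < right_slope f x + e"
    unfolding right_slope_def by (subst (asm) cINF_less_iff) (use bdd_slopes assms in auto)
  then show ?thesis using that by auto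
qed

lemma right_slope_deriv:
  assumes x: "0 \<le> x" "x < 1"
  shows "(f has_real_derivative right_slope f x) (at_right x)"
  unfolding has_field_derivative_iff
proof (rule order_tendstoI)
  fix a assume a: "a < right_slope f x"
  have "eventually (\<lambda>y. y \<in> {x<..<1}) (at_right x)"
    by (rule eventually_at_right_real) (use x in simp)
  then show "eventually (\<lambda>y. a < sl x y) (at_right x)"
  proof eventually_elim
    case (elim y)
    then show ?case using right_slope_le_slope[OF x(1), of y] a by auto
  qed
next
  fix a assume a: "right_slope f x < a"
  obtain z where z: "x < z" "z \<le> 1" "sl x z < right_slope f x + (a - right_slope f x)"
    using slope_near[OF x, of "a - right_slope f x"] a by auto
  have "eventually (\<lambda>y. y \<in> {x<..<z}) (at_right x)"
    by (rule eventually_at_right_real) (use z in simp)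
  then show "eventually (\<lambda>y. sl x y < a) (at_right x)"
  proof eventually_elim
    case (elim y)
    then show ?case using convex_on_slope_mono(1)[OF conv, of x y z] x z by auto
  qed
qed

text \<open>The slope from \<open>y\<close> to a fixed \<open>z\<close> depends continuously on
  \<open>y\<close> and dominates \<open>right_slope f y\<close>, which bounds the values to the
  right of \<open>x\<close> from above. Monotonicity bounds them from below.\<close>

lemma right_slope_right_continuous:
  assumes x: "0 \<le> x" "x < 1"
  shows "continuous (at_right x) (right_slope f)"
  unfolding continuous_within
proof (rule order_tendstoI)
  fix a assume a: "a < right_slope f x"
  have "eventually (\<lambda>y. y \<in> {x<..<1}) (at_right x)"
    by (rule eventually_at_right_real) (use x in simp)
  then show "eventually (\<lambda>y. a < right_slope f y) (at_right x)"
  proof eventually_elim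
    case (elim y)
    then show ?case using mono_onD[OF right_slope_mono, of x y] x a by auto
  qed
next
  fix a assume a: "right_slope f x < a"
  obtain z where z: "x < z" "z \<le> 1" "sl x z < a"
    using slope_near[OF x, of "a - right_slope f x"] a by auto
  have "continuous (at_right x) f"
    using right_slope_deriv[OF x] DERIV_continuous by blast
  then have "((\<lambda>y. sl y z) \<longlongrightarrow> sl x z) (at_right x)"
    using z by (intro tendsto_intros) (auto simp: continuous_within)
  then have "eventually (\<lambda>y. sl y z < a) (at_right x)"
    using z by (auto dest: order_tendstoD)
  moreover have "eventually (\<lambda>y. y \<in> {x<..<z}) (at_right x)"
    by (rule eventually_at_right_real) (use z in simp)
  ultimately show "eventually (\<lambda>y. right_slope f y < a) (at_right x)"
  proof eventually_elim
    case (elim y)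
    then show ?case using right_slope_le_slope[of y z] x z by auto
  qed
qed

lemma right_slope_has_integral:
  assumes "0 \<le> a" "a \<le> b" "b < 1"
  shows "(right_slope f has_integral f b - f a) {a..b}"
  by (rule integral_eq_if_sandwich)
    (use assms right_slope_mono right_slope_lower right_slope_upper in \<open>auto simp: mono_on_def\<close>)

end

lemma rderiv_eqI:
  assumes "(f has_real_derivative d) (at_right s)"
  shows "rderiv f s = d"
  unfolding rderiv_def
proof (rule the_equality)
  fix d' assume "(f has_real_derivative d') (at_right s)"
  from has_field_derivative_unique[OF this assms] show "d' = d" by simp
qed (fact assms)

section \<open>The concave envelope\<close>

lemma concave_on_min:
  fixes f g :: "real \<Rightarrow> real"
  assumes "concave_on A f" "concave_on A g"
  shows "concave_on A (\<lambda>x. min (f x) (g x))"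
  unfolding concave_on_iff
proof (intro conjI ballI allI impI)
  show "convex A" using assms(1) by (rule concave_on_imp_convex)
  fix x y u v :: real
  assume *: "x \<in> A" "y \<in> A" "0 \<le> u" "0 \<le> v" "u + v = 1"
  have 1: "u * f x + v * f y \<le> f (u *\<^sub>R x + v *\<^sub>R y)" "u * g x + v * g y \<le> g (u *\<^sub>R x + v *\<^sub>R y)"
    using assms * unfolding concave_on_iff by auto
  have "u * min (f x) (g x) \<le> u * f x" "u * min (f x) (g x) \<le> u * g x"
    "v * min (f y) (g y) \<le> v * f y" "v * min (f y) (g y) \<le> v * g y"
    using * by (auto intro: mult_left_mono)
  then show "u * min (f x) (g x) + v * min (f y) (g y) \<le>
    min (f (u *\<^sub>R x + v *\<^sub>R y)) (g (u *\<^sub>R x + v *\<^sub>R y))" using 1 by linarith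
qed

lemma concave_on_affine: "convex A \<Longrightarrow> concave_on A (\<lambda>x::real. c + m * x)"
  unfolding concave_on_iff
proof (intro conjI ballI allI impI)
  fix x y u v :: real assume "u + v = 1"
  then have "c = (u + v) * c" by simp
  then show "u * (c + m * x) + v * (c + m * y) \<le> c + m * (u *\<^sub>R x + v *\<^sub>R y)"
    by (simp add: algebra_simps)
qed

text \<open>\<open>HK0\<close> and \<open>HK1\<close> put two lines above \<open>H\<close>, of slope
  \<open>K\<close> through \<open>(0, 0)\<close> and of slope \<open>- K\<close> through
  \<open>(1, H 1)\<close>. They suffice to make the envelope Lipschitz although \<open>H\<close>
  need not be. The modulus \<open>B\<close> controls the increments of \<open>H\<close> and, by its
  second term, those of the envelope too.\<close>

locale envelope =
  fixes H B :: "real \<Rightarrow> real" and K :: real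
  assumes H0: "H 0 = 0" and HK0: "\<And>s. 0 \<le> s \<Longrightarrow> s \<le> 1 \<Longrightarrow> H s \<le> K * s"
    and HK1: "\<And>s. 0 \<le> s \<Longrightarrow> s \<le> 1 \<Longrightarrow> H s \<le> H 1 + K * (1 - s)"
    and B: "\<And>x y. 0 \<le> x \<Longrightarrow> x \<le> y \<Longrightarrow> y \<le> 1 \<Longrightarrow> \<bar>H y - H x\<bar> + K * (y - x) \<le> B y - B x"
    and contB: "continuous_on {0..1} B"
    and K0: "0 \<le> K"
begin

abbreviation "E \<equiv> concave_envelope H"

lemma env_greatest:
  assumes "\<And>g. concave_on {0..1} g \<Longrightarrow> (\<forall>t\<in>{0..1}. H t \<le> g t) \<Longrightarrow> c \<le> g s"
  shows "c \<le> E s"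
  unfolding concave_envelope_def
proof (rule cInf_greatest)
  have "concave_on {0..1} (\<lambda>x. 0 + K * x)" by (rule concave_on_affine) simp
  then have "concave_on {0..1} (\<lambda>x. 0 + K * x) \<and> (\<forall>t\<in>{0..1}. H t \<le> 0 + K * t)" using HK0 by simp
  then show "{g s |g. concave_on {0..1} g \<and> (\<forall>t\<in>{0..1}. H t \<le> g t)} \<noteq> {}" by blast
qed (use assms in auto)

lemma env_ge:
  assumes "0 \<le> s" "s \<le> 1"
  shows "H s \<le> E s"
  by (rule env_greatest) (use assms in auto)

lemma env_le:
  assumes "concave_on {0..1} g" "\<And>t. 0 \<le> t \<Longrightarrow> t \<le> 1 \<Longrightarrow> H t \<le> g t" "0 \<le> s" "s \<le> 1"
  shows "E s \<le> g s"
  unfolding concave_envelope_def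
proof (rule cInf_lower)
  show "bdd_below {g s |g. concave_on {0..1} g \<and> (\<forall>t\<in>{0..1}. H t \<le> g t)}"
    by (rule bdd_belowI[of _ "H s"]) (use assms(3,4) in auto)
qed (use assms in auto)

lemma env_concave: "concave_on {0..1} E"
  unfolding concave_on_iff
proof (intro conjI ballI allI impI)
  fix x y u v :: real
  assume *: "x \<in> {0..1}" "y \<in> {0..1}" "0 \<le> u" "0 \<le> v" "u + v = 1"
  show "u * E x + v * E y \<le> E (u *\<^sub>R x + v *\<^sub>R y)"
  proof (rule env_greatest)
    fix g assume g: "concave_on {0..1} g" "\<forall>t\<in>{0..1}. H t \<le> g t"
    have "E x \<le> g x" "E y \<le> g y" using env_le[OF g(1)] g(2) * by auto
    then have "u * E x + v * E y \<le> u * g x + v * g y"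
      using * by (intro add_mono mult_left_mono) auto
    also have "\<dots> \<le> g (u *\<^sub>R x + v *\<^sub>R y)"
      using g(1) * unfolding concave_on_iff by blast
    finally show "u * E x + v * E y \<le> g (u *\<^sub>R x + v *\<^sub>R y)" .
  qed
qed simp

lemma env_le_0:
  assumes "0 \<le> s" "s \<le> 1" shows "E s \<le> K * s"
  by (rule env_le) (use HK0 concave_on_affine[of "{0..1}" 0 K] assms in auto)

lemma env_0: "E 0 = 0"
  using env_ge[of 0] env_le_0[of 0] H0 by simp

lemma env_1: "E 1 = H 1"
proof -
  have "(\<lambda>x. (H 1 + K) + (- K) * x) = (\<lambda>x. H 1 + K * (1 - x))" by (auto simp: algebra_simps)
  then have "concave_on {0..1} (\<lambda>x. H 1 + K * (1 - x))"
    using concave_on_affine[of "{0..1}" "H 1 + K" "- K"] by simp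
  then show ?thesis using env_ge[of 1] env_le[of "\<lambda>x. H 1 + K * (1 - x)" 1] HK1 by simp
qed

lemma env_le_1:
  assumes "0 \<le> s" "s \<le> 1" shows "E s \<le> E 1 + K * (1 - s)"
proof -
  have "(\<lambda>x. (H 1 + K) + (- K) * x) = (\<lambda>x. H 1 + K * (1 - x))" by (auto simp: algebra_simps)
  then have "concave_on {0..1} (\<lambda>x. H 1 + K * (1 - x))"
    using concave_on_affine[of "{0..1}" "H 1 + K" "- K"] by simp
  then show ?thesis using env_le[of "\<lambda>x. H 1 + K * (1 - x)" s] HK1 assms by (simp add: env_1)
qed

lemma convex_neg: "convex_on {0..1} (\<lambda>x. - E x)"
  using env_concave unfolding concave_on_def .

lemma env_slope:
  assumes "0 \<le> x" "x < t" "t < y" "y \<le> 1"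
  shows "(E y - E x) / (y - x) \<le> (E t - E x) / (t - x)"
    and "(E y - E t) / (y - t) \<le> (E y - E x) / (y - x)"
proof -
  have e: "(- a - - b) / c = - ((a - b) / c)" for a b c :: real
    by (metis minus_diff_minus minus_divide_left)
  show "(E y - E x) / (y - x) \<le> (E t - E x) / (t - x)" "(E y - E t) / (y - t) \<le> (E y - E x) / (y - x)"
    using convex_on_slope_mono[OF convex_neg assms] unfolding e by simp_all
qed

text \<open>Chord slopes of a concave function decrease, so each lies between the slope of a chord
  that ends at 1 and that of a chord that starts at 0. These are bounded by the two lines above
  \<open>H\<close>.\<close>

lemma env_lipschitz:
  assumes "0 \<le> x" "x \<le> y" "y \<le> 1"
  shows "E y - E x \<le> K * (y - x)" "E x - E y \<le> K * (y - x)"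
proof -
  have 1: "E y - E x \<le> K * (y - x) \<and> E x - E y \<le> K * (y - x)" if xy: "x < y"
  proof
    have "(E y - E x) / (y - x) \<le> K"
    proof (cases "x = 0")
      case True then show ?thesis using env_le_0[of y] assms xy env_0 by (simp add: field_simps)
    next
      case False
      then have "(E y - E x) / (y - x) \<le> (E y - E 0) / (y - 0)" using env_slope(2)[of 0 x y] assms xy by auto
      also have "\<dots> \<le> K" using env_le_0[of y] assms xy env_0 by (simp add: field_simps)
      finally show ?thesis .
    qed
    then show "E y - E x \<le> K * (y - x)" using xy by (simp add: field_simps)
    have s1: "- K \<le> (E 1 - E x) / (1 - x)"
      using env_le_1[of x] assms xy by (simp add: field_simps)
    have "- K \<le> (E y - E x) / (y - x)"
    proof (cases "y = 1")
      case False
      then have "(E 1 - E x) / (1 - x) \<le> (E y - E x) / (y - x)" using env_slope(1)[of x y 1] assms xy by auto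
      then show ?thesis using s1 by simp
    qed (use s1 in simp)
    then have "- K * (y - x) \<le> E y - E x" using xy by (simp add: pos_le_divide_eq)
    then show "E x - E y \<le> K * (y - x)" by simp
  qed
  show "E y - E x \<le> K * (y - x)" "E x - E y \<le> K * (y - x)" using 1 assms by (cases "x = y"; simp)+
qed

sublocale neg: convex_lower_lipschitz "\<lambda>x. - E x" "- K"
proof
  fix x y :: real assume "0 \<le> x" "x < y" "y \<le> 1"
  then show "- K * (y - x) \<le> - E y - - E x" using env_lipschitz(1)[of x y] by simp
qed (fact convex_neg)

text \<open>The minimum of the envelope and one of its chords replaces the envelope by the chord
  between the end points of the chord, hence the envelope is affine there.\<close>
lemma env_eq_chord:
  assumes xy: "0 \<le> x" "x < y" "y \<le> 1"
    and above: "\<And>t. x \<le> t \<Longrightarrow> t \<le> y \<Longrightarrow> H t \<le> E x + (E y - E x) / (y - x) * (t - x)"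
    and t: "x \<le> t" "t \<le> y"
  shows "E t = E x + (E y - E x) / (y - x) * (t - x)"
proof -
  define m where "m = (E y - E x) / (y - x)"
  define l where "l s = E x + m * (s - x)" for s
  have l_eq: "l = (\<lambda>s. (E x - m * x) + m * s)" by (auto simp: l_def algebra_simps)
  have lc: "concave_on {0..1} l" unfolding l_eq by (rule concave_on_affine) simp
  have ly: "l y = E y" using xy by (simp add: l_def m_def)
  have l_in: "l s \<le> E s" if s: "x \<le> s" "s \<le> y" for s
  proof (cases "s = x \<or> s = y")
    case False
    then have s': "x < s" "s < y" using s by auto
    have "m \<le> (E s - E x) / (s - x)" using env_slope(1)[of x s y] s' xy by (simp add: m_def)
    then show ?thesis using s' by (simp add: l_def field_simps)
  next
    case True then show ?thesis using ly by (auto simp: l_def)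
  qed
  have l_out: "E s \<le> l s" if s: "0 \<le> s" "s \<le> 1" "s < x \<or> y < s" for s
  proof (cases "s < x")
    case True
    have "(E y - E x) / (y - x) \<le> (E x - E s) / (x - s)"
      using env_slope(1)[of s x y] env_slope(2)[of s x y] True xy s by linarith
    then have "m * (x - s) \<le> E x - E s" using True by (simp add: m_def pos_le_divide_eq)
    then show ?thesis by (simp add: l_def algebra_simps)
  next
    case False
    then have ys: "y < s" using s by auto
    have "(E s - E x) / (s - x) \<le> m"
      using env_slope(1)[of x y s] ys xy s by (simp add: m_def)
    then show ?thesis using ys xy by (simp add: l_def pos_divide_le_eq)
  qed
  have "E t \<le> min (E t) (l t)"
  proof (rule env_le[OF concave_on_min[OF env_concave lc]])
    fix s :: real assume s: "0 \<le> s" "s \<le> 1"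
    show "H s \<le> min (E s) (l s)"
      using above[of s] env_ge[OF s] l_out[OF s] unfolding l_def m_def by linarith
  qed (use xy t in auto)
  then show ?thesis using l_in[OF t] by (simp add: l_def m_def)
qed

abbreviation "P \<equiv> right_slope (\<lambda>x. - E x)"

lemma right_slope_const_on_affine:
  assumes xy: "0 \<le> x" "x < y" "y \<le> 1"
    and aff: "\<And>t. x \<le> t \<Longrightarrow> t \<le> y \<Longrightarrow> E t = E x + m * (t - x)"
    and t: "x \<le> t" "t < y"
  shows "P t = - m"
proof -
  have gen: "\<And>a b c :: real. \<bar>a - c\<bar> \<le> b \<Longrightarrow> \<not> b \<le> c \<Longrightarrow> a \<le> 2 * b" by linarith
  have ev: "eventually (\<lambda>s. s \<in> {t<..<y}) (at_right t)" by (rule eventually_at_right_real[OF t(2)])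
  have "eventually (\<lambda>s. (- E s - - E t) / (s - t) = - m) (at_right t)"
    using ev
  proof eventually_elim
    case (elim s)
    then have "E s - E t = m * (s - t)" using aff[of s] aff[of t] t by (simp add: algebra_simps)
    then have "- E s - - E t = (- m) * (s - t)" by simp
    then show ?case using elim by (simp add: nonzero_eq_divide_eq)
  qed
  then have "((\<lambda>s. (- E s - - E t) / (s - t)) \<longlongrightarrow> - m) (at_right t)"
    by (rule tendsto_eventually)
  moreover have "((\<lambda>s. (- E s - - E t) / (s - t)) \<longlongrightarrow> P t) (at_right t)"
    using neg.right_slope_deriv[of t] xy t by (simp only: has_field_derivative_iff)
  ultimately show ?thesis by (intro tendsto_unique[of "at_right t"]) auto
qed

section \<open>The slack between \<open>H\<close> and its envelope\<close>

abbreviation "S x \<equiv> E x - H x"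

lemma S_nonneg: "0 \<le> x \<Longrightarrow> x \<le> 1 \<Longrightarrow> 0 \<le> S x"
  using env_ge by auto

lemma S_modulus:
  assumes "0 \<le> x" "x \<le> y" "y \<le> 1"
  shows "\<bar>S y - S x\<bar> \<le> B y - B x"
  using B[OF assms] env_lipschitz[OF assms] by linarith

lemma B_mono: "0 \<le> x \<Longrightarrow> x \<le> y \<Longrightarrow> y \<le> 1 \<Longrightarrow> B x \<le> B y"
  using S_modulus[of x y] by linarith

text \<open>If the slack is at least \<open>B z - B x\<close> on some \<open>{x..z}\<close> with
  \<open>z > y\<close>, then the chord of \<open>E\<close> over this interval still lies above
  \<open>H\<close>, as \<open>E\<close> varies there by at most \<open>K * (z - x)\<close>. So
  \<open>E\<close> is affine and \<open>P\<close> is constant. Here \<open>z\<close> lies beyond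
  \<open>y\<close> because \<open>P y\<close> is a slope to the right. Otherwise the slack is small
  somewhere on \<open>{x..z}\<close>, hence at most \<open>2 * (B z - B x)\<close> at
  \<open>y\<close>, and \<open>z\<close> tends to \<open>y\<close>.\<close>

lemma slack:
  assumes xy: "0 \<le> x" "x \<le> y" "y < 1"
  shows "P x = P y \<or> S y \<le> 2 * (B y - B x)"
proof (cases "\<exists>z. y < z \<and> z \<le> 1 \<and> (\<forall>t. x \<le> t \<longrightarrow> t \<le> z \<longrightarrow> B z - B x \<le> S t)")
  case True
  then obtain z where z: "y < z" "z \<le> 1" "\<And>t. x \<le> t \<Longrightarrow> t \<le> z \<Longrightarrow> B z - B x \<le> S t" by blast
  have above: "H t \<le> E x + (E z - E x) / (z - x) * (t - x)" if t: "x \<le> t" "t \<le> z" for t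
  proof -
    define a where "a = (t - x) / (z - x)"
    have a: "0 \<le> a" "a \<le> 1" using t xy z by (auto simp: a_def)
    \<comment> \<open>Both end values of \<open>E\<close> are at least
      \<open>E t - K * (z - x)\<close>, hence so is the value of the chord at
      \<open>t\<close>.\<close>
    have "E t - K * (z - x) \<le> E x"
      using env_lipschitz[of x t] t xy z K0 mult_left_mono[of "t - x" "z - x" K] by auto
    moreover have "E t - K * (z - x) \<le> E z"
      using env_lipschitz[of t z] t xy z K0 mult_left_mono[of "z - t" "z - x" K] by auto
    ultimately have "(1 - a) * (E t - K * (z - x)) + a * (E t - K * (z - x)) \<le> (1 - a) * E x + a * E z"
      using a by (intro add_mono mult_left_mono) auto
    then have "E t - K * (z - x) \<le> E x + a * (E z - E x)" by (simp add: algebra_simps)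
    moreover have "K * (z - x) \<le> B z - B x" using B[of x z] xy z by auto
    moreover have "B z - B x \<le> E t - H t" using z(3)[OF t] .
    ultimately have "H t \<le> E x + a * (E z - E x)" by linarith
    then show ?thesis by (simp add: a_def mult.commute)
  qed
  have aff: "E t = E x + (E z - E x) / (z - x) * (t - x)" if "x \<le> t" "t \<le> z" for t
    by (rule env_eq_chord[OF _ _ _ above]) (use that xy z(1,2) in auto)
  have Pt: "P t = - ((E z - E x) / (z - x))" if "x \<le> t" "t < z" for t
    by (rule right_slope_const_on_affine[OF _ _ _ aff]) (use that xy z(1,2) in auto)
  have "P x = P y" using Pt[of x] Pt[of y] xy z(1) by linarith
  then show ?thesis ..
next
  case False
  have gen: "\<And>a b c :: real. \<bar>a - c\<bar> \<le> b \<Longrightarrow> \<not> b \<le> c \<Longrightarrow> a \<le> 2 * b" by linarith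
  have ev: "eventually (\<lambda>z. S y \<le> 2 * (B z - B x)) (at_right y)"
  proof -
    have "eventually (\<lambda>z. z \<in> {y<..<1}) (at_right y)" by (rule eventually_at_right_real[OF xy(3)])
    then show ?thesis
    proof eventually_elim
      case (elim z)
      then have z: "y < z" "z \<le> 1" by auto
      have "\<not> (\<forall>t. x \<le> t \<longrightarrow> t \<le> z \<longrightarrow> B z - B x \<le> S t)"
        using False z by blast
      then obtain t where t: "x \<le> t" "t \<le> z" "\<not> B z - B x \<le> S t" by blast
      have "\<bar>S y - S t\<bar> \<le> B z - B x"
      proof (cases "t \<le> y")
        case True
        show ?thesis
          using S_modulus[OF _ True] B_mono[of x t] B_mono[of y z] t z xy by linarith
      next
        case False
        then have "y \<le> t" by simp
        then show ?thesis
          using S_modulus[of y t] B_mono[of x y] B_mono[of t z] t z xy by linarith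
      qed
      then show ?case by (rule gen) (rule t(3))
    qed
  qed
  have lim: "((\<lambda>z. 2 * (B z - B x)) \<longlongrightarrow> 2 * (B y - B x)) (at_right y)"
  proof -
    have "(B \<longlongrightarrow> B y) (at y within {0..1})" using contB xy by (auto simp: continuous_on_def)
    then have "(B \<longlongrightarrow> B y) (at y within {y<..1})"
      by (rule tendsto_within_subset) (use xy in auto)
    moreover have "at y within {y<..1} = at_right y"
      by (rule at_within_nhd[of _ "{y-1<..<1}"]) (use xy in auto)
    ultimately show ?thesis by (auto intro!: tendsto_intros)
  qed
  have "S y \<le> 2 * (B y - B x)"
    by (rule tendsto_lowerbound[OF lim ev]) simp
  then show ?thesis ..
qed

text \<open>At 1 there are no slopes to the right. The value \<open>K\<close>, an upper bound of
  \<open>P\<close> on \<open>{0..<1}\<close>, keeps the function increasing on the closed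
  interval.\<close>

definition "P1 x = (if x < 1 then P x else K)"

definition "\<phi> x = max 0 (P1 x)"

lemma P_bounds: assumes "0 \<le> x" "x < 1" shows "- K \<le> P x" "P x \<le> K"
proof -
  show "- K \<le> P x" by (rule neg.right_slope_ge) (use assms in auto)
  have "P x \<le> (- E 1 - - E x) / (1 - x)" by (rule neg.right_slope_le_slope) (use assms in auto)
  also have "\<dots> \<le> K" using env_le_1[of x] assms by (simp add: field_simps)
  finally show "P x \<le> K" .
qed

lemma P1_mono: "mono_on {0..1} P1"
proof (rule mono_onI)
  fix x y :: real assume xy: "x \<in> {0..1}" "y \<in> {0..1}" "x \<le> y"
  show "P1 x \<le> P1 y"
  proof (cases "y < 1")
    case True
    then show ?thesis using mono_onD[OF neg.right_slope_mono, of x y] xy by (simp add: P1_def)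
  next
    case False
    then show ?thesis using P_bounds(2)[of x] xy by (cases "x < 1") (simp_all add: P1_def)
  qed
qed

lemma P1_has_integral:
  assumes "0 \<le> x" "x \<le> y" "y \<le> 1"
  shows "(P1 has_integral E x - E y) {x..y}"
proof -
  have "(P1 has_integral (\<lambda>x. - E x) y - (\<lambda>x. - E x) x) {x..y}"
  proof (rule integral_eq_if_sandwich)
    fix u v assume uv: "x \<le> u" "u < v" "v \<le> y"
    show "P1 u * (v - u) \<le> - E v - - E u"
      using neg.right_slope_lower[of u v] uv assms by (simp add: P1_def)
    \<comment> \<open>For \<open>v = 1\<close> this is the Lipschitz bound on
      \<open>E\<close>.\<close>
    show "- E v - - E u \<le> P1 v * (v - u)"
      using neg.right_slope_upper[of u v] env_lipschitz[of u v] uv assms by (auto simp: P1_def)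
  qed (use assms P1_mono in \<open>auto simp: mono_on_def\<close>)
  then show ?thesis by simp
qed

lemma phi_mono: "mono_on {0..1} \<phi>"
  unfolding \<phi>_def by (rule mono_onI) (rule max.mono[OF order_refl mono_onD[OF P1_mono]])

lemma phi_nonneg: "0 \<le> \<phi> x"
  by (simp add: \<phi>_def)

lemma phi_le: "0 \<le> x \<Longrightarrow> x \<le> 1 \<Longrightarrow> \<phi> x \<le> K"
  using P_bounds(2)[of x] K0 by (cases "x < 1") (simp_all add: \<phi>_def P1_def)

end

section \<open>The cone projection\<close>

text \<open>The bounds say that at each \<open>z\<close> the line of slope \<open>p z\<close>
  supports \<open>f\<close> from both sides. In the combination of the bounds towards
  \<open>x\<close> and \<open>y\<close> with weights \<open>1 - t\<close> and \<open>t\<close> the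
  terms with \<open>p z\<close> cancel.\<close>

lemma convex_on_if_increments:
  fixes f p :: "real \<Rightarrow> real"
  assumes "\<And>x y. a \<le> x \<Longrightarrow> x \<le> y \<Longrightarrow> y \<le> b \<Longrightarrow> p x * (y - x) \<le> f y - f x"
    and "\<And>x y. a \<le> x \<Longrightarrow> x \<le> y \<Longrightarrow> y \<le> b \<Longrightarrow> f y - f x \<le> p y * (y - x)"
  shows "convex_on {a..b} f"
proof (rule convex_on_linorderI)
  fix t x y :: real
  assume t: "t > 0" "t < 1" and xy: "x \<in> {a..b}" "y \<in> {a..b}" "x < y"
  define z where "z = (1 - t) *\<^sub>R x + t *\<^sub>R y"
  have zx: "z - x = t * (y - x)" and yz: "y - z = (1 - t) * (y - x)"
    by (auto simp: z_def algebra_simps)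
  have "0 \<le> z - x" "0 \<le> y - z" unfolding zx yz using t xy by auto
  then have "f z - f x \<le> p z * (z - x)" "p z * (y - z) \<le> f y - f z"
    using assms(2)[of x z] assms(1)[of z y] xy by auto
  then have "(1 - t) * (f z - f x) \<le> (1 - t) * (p z * (t * (y - x)))"
    "t * (p z * ((1 - t) * (y - x))) \<le> t * (f y - f z)"
    unfolding zx yz using t by (auto intro!: mult_left_mono)
  then show "f ((1 - t) *\<^sub>R x + t *\<^sub>R y) \<le> (1 - t) * f x + t * f y"
    unfolding z_def[symmetric] by (simp add: algebra_simps)
qed simp

text \<open>The lower bound is confined to the right half of the interval, since \<open>h\<close>
  may be unbounded below near 0. Any cut strictly between 0 and 1 would do in place of
  \<open>1 / 2\<close>, with other constants.\<close>

locale isotonic =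
  fixes h :: "real \<Rightarrow> real" and K :: real
  assumes h_int: "h absolutely_integrable_on {0..1}"
    and h_le: "\<And>s. 0 \<le> s \<Longrightarrow> s \<le> 1 \<Longrightarrow> h s \<le> K"
    and h_ge: "\<And>s. 1 / 2 \<le> s \<Longrightarrow> s \<le> 1 \<Longrightarrow> - K \<le> h s"
    and K0: "0 \<le> K"
begin

definition "H s = integral {0..s} h"

definition "M = integral {0..1} (\<lambda>t. \<bar>h t\<bar>)"

text \<open>The density \<open>\<bar>h t\<bar>\<close> accounts for the increments of
  \<open>H\<close>, the constant \<open>K + 2 * M\<close> for the Lipschitz constant of the
  envelope.\<close>

definition "B s = integral {0..s} (\<lambda>t. \<bar>h t\<bar> + (K + 2 * M))"

lemma h_on: "0 \<le> x \<Longrightarrow> y \<le> 1 \<Longrightarrow> h integrable_on {x..y}"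
  using integrable_on_subinterval[OF set_lebesgue_integral_eq_integral(1)[OF h_int], of x y] by auto

lemma abs_h_on: "0 \<le> x \<Longrightarrow> y \<le> 1 \<Longrightarrow> (\<lambda>t. \<bar>h t\<bar>) integrable_on {x..y}"
  using integrable_on_subinterval[OF absolutely_integrable_on_def[THEN iffD1, OF h_int, THEN conjunct2], of x y]
  by auto

lemma const_on: "(\<lambda>_. c :: real) integrable_on {x..y :: real}"
  by (rule integrable_const_ivl)

lemma H_diff: "0 \<le> x \<Longrightarrow> x \<le> y \<Longrightarrow> y \<le> 1 \<Longrightarrow> H y - H x = integral {x..y} h"
  using Henstock_Kurzweil_Integration.integral_combine[OF _ _ h_on, of 0 x y] by (simp add: H_def)

lemma B_diff:
  "0 \<le> x \<Longrightarrow> x \<le> y \<Longrightarrow> y \<le> 1 \<Longrightarrow> B y - B x = integral {x..y} (\<lambda>t. \<bar>h t\<bar>) + (K + 2 * M) * (y - x)"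
  using Henstock_Kurzweil_Integration.integral_combine[of 0 x y "\<lambda>t. \<bar>h t\<bar> + (K + 2 * M)"]
    Henstock_Kurzweil_Integration.integral_add[OF abs_h_on const_on, of x y "K + 2 * M"]
    integrable_add[OF abs_h_on const_on, of 0 y "K + 2 * M"]
  by (simp add: B_def algebra_simps)

lemma abs_H_diff:
  assumes "0 \<le> x" "x \<le> y" "y \<le> 1"
  shows "\<bar>H y - H x\<bar> \<le> integral {x..y} (\<lambda>t. \<bar>h t\<bar>)"
  unfolding H_diff[OF assms]
  using Henstock_Kurzweil_Integration.integral_norm_bound_integral[OF h_on abs_h_on, of x y] assms by auto

lemma M_bound:
  assumes "0 \<le> x" "x \<le> y" "y \<le> 1"
  shows "integral {x..y} (\<lambda>t. \<bar>h t\<bar>) \<le> M"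
  unfolding M_def by (rule integral_subset_le) (use assms abs_h_on in auto)

lemma M0: "0 \<le> M"
  unfolding M_def by (rule Henstock_Kurzweil_Integration.integral_nonneg) (use abs_h_on in auto)

text \<open>The summand \<open>2 * M\<close> stems from the line through \<open>(1, H 1)\<close>.
  For \<open>s < 1 / 2\<close> no lower bound on \<open>h\<close> applies, but
  \<open>H s - H 1\<close> is at most the norm \<open>M\<close>, and
  \<open>1 \<le> 2 * (1 - s)\<close>.\<close>

sublocale envelope H B "K + 2 * M"
proof
  show "H 0 = 0" by (simp add: H_def)
  fix s :: real assume s: "0 \<le> s" "s \<le> 1"
  have "H s \<le> integral {0..s} (\<lambda>_. K)"
    unfolding H_def by (rule integral_le[OF h_on const_on]) (use s h_le in auto)
  also have "\<dots> \<le> (K + 2 * M) * s" using s M0 by (simp add: algebra_simps)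
  finally show "H s \<le> (K + 2 * M) * s" .
  show "H s \<le> H 1 + (K + 2 * M) * (1 - s)"
  proof (cases "s \<ge> 1 / 2")
    case True
    have "integral {s..1} (\<lambda>_. - K) \<le> H 1 - H s"
      unfolding H_diff[OF s order_refl] by (rule integral_le[OF const_on h_on]) (use s h_ge True in auto)
    then have "H s \<le> H 1 + K * (1 - s)" using s by (simp add: algebra_simps)
    also have "\<dots> \<le> H 1 + (K + 2 * M) * (1 - s)"
      using M0 s by (intro add_left_mono mult_right_mono) auto
    finally show ?thesis .
  next
    case False
    have "H s - H 1 \<le> M" using abs_H_diff[OF s order_refl] M_bound[OF s order_refl] by linarith
    also have "\<dots> \<le> (2 * M) * (1 - s)" using False M0 mult_left_mono[of "1" "2 * (1 - s)" M]
      by (simp add: algebra_simps)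
    also have "\<dots> \<le> (K + 2 * M) * (1 - s)" using K0 s by (intro mult_right_mono) auto
    finally show ?thesis by simp
  qed
next
  fix x y :: real assume xy: "0 \<le> x" "x \<le> y" "y \<le> 1"
  show "\<bar>H y - H x\<bar> + (K + 2 * M) * (y - x) \<le> B y - B x"
    using abs_H_diff[OF xy] B_diff[OF xy] by simp
next
  show "continuous_on {0..1} B"
    unfolding B_def by (rule indefinite_integral_continuous_1) (use abs_h_on[of 0 1] const_on in \<open>auto intro: integrable_add\<close>)
  show "0 \<le> K + 2 * M" using K0 M0 by simp
qed

section \<open>The candidate \<open>W\<close> and its optimality conditions\<close>

definition "W s = integral {0..s} \<phi>"

lemma phi_on: "0 \<le> x \<Longrightarrow> y \<le> 1 \<Longrightarrow> \<phi> integrable_on {x..y}"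
  by (rule integrable_on_mono_on) (use phi_mono in \<open>auto simp: mono_on_def\<close>)

lemma P1_on: "0 \<le> x \<Longrightarrow> y \<le> 1 \<Longrightarrow> P1 integrable_on {x..y}"
  by (rule integrable_on_mono_on) (use P1_mono in \<open>auto simp: mono_on_def\<close>)

lemma W_diff: "0 \<le> x \<Longrightarrow> x \<le> y \<Longrightarrow> y \<le> 1 \<Longrightarrow> W y - W x = integral {x..y} \<phi>"
  using Henstock_Kurzweil_Integration.integral_combine[OF _ _ phi_on, of 0 x y] by (simp add: W_def)

lemma W_lower:
  assumes "0 \<le> x" "x \<le> y" "y \<le> 1" shows "\<phi> x * (y - x) \<le> W y - W x"
proof -
  have "integral {x..y} (\<lambda>_. \<phi> x) \<le> integral {x..y} \<phi>"
    by (rule integral_le[OF const_on phi_on]) (use assms mono_onD[OF phi_mono, of x] in auto)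
  then show ?thesis using W_diff[OF assms] assms by (simp add: mult.commute)
qed

lemma W_upper:
  assumes "0 \<le> x" "x \<le> y" "y \<le> 1" shows "W y - W x \<le> \<phi> y * (y - x)"
proof -
  have "integral {x..y} \<phi> \<le> integral {x..y} (\<lambda>_. \<phi> y)"
    by (rule integral_le[OF phi_on const_on]) (use assms mono_onD[OF phi_mono, of _ y] in auto)
  then show ?thesis using W_diff[OF assms] assms by (simp add: mult.commute)
qed

lemma W_mono: "mono_on {0..1} W"
proof (rule mono_onI)
  fix x y :: real assume xy: "x \<in> {0..1}" "y \<in> {0..1}" "x \<le> y"
  have "0 \<le> \<phi> x * (y - x)" using xy phi_nonneg by simp
  then show "W x \<le> W y" using W_lower[of x y] xy by auto
qed

lemma W_0: "W 0 = 0" by (simp add: W_def)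

lemma W_Wicx: "W \<in> Wicx"
  unfolding Wicx_def
  using W_mono W_0 mono_onD[OF W_mono, of 0] convex_on_if_increments[OF W_lower W_upper] by auto

lemma W_cont: "continuous_on {0..1} W"
  unfolding W_def by (rule indefinite_integral_continuous_1[OF phi_on]) auto

text \<open>The difference quotient between \<open>s\<close> and \<open>y\<close> lies between
  \<open>\<phi> s\<close> and \<open>\<phi> y\<close>, so right continuity of \<open>P\<close>
  yields the limit.\<close>

lemma W_right_deriv:
  assumes s: "0 \<le> s" "s < 1"
  shows "(W has_real_derivative max 0 (P s)) (at_right s)"
  unfolding has_field_derivative_iff
proof (rule tendsto_sandwich)
  have ev: "eventually (\<lambda>y. y \<in> {s<..<1}) (at_right s)" by (rule eventually_at_right_real[OF s(2)])
  show "eventually (\<lambda>y. max 0 (P s) \<le> (W y - W s) / (y - s)) (at_right s)"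
    using ev
  proof eventually_elim
    case (elim y)
    then have "\<phi> s * (y - s) \<le> W y - W s" using W_lower[of s y] s by simp
    then have "\<phi> s \<le> (W y - W s) / (y - s)" using elim by (simp add: pos_le_divide_eq)
    then show ?case using s by (simp add: \<phi>_def P1_def)
  qed
  show "eventually (\<lambda>y. (W y - W s) / (y - s) \<le> max 0 (P y)) (at_right s)"
    using ev
  proof eventually_elim
    case (elim y)
    then show ?case using W_upper[of s y] s by (simp add: pos_divide_le_eq \<phi>_def P1_def)
  qed
  have "(P \<longlongrightarrow> P s) (at_right s)"
    using neg.right_slope_right_continuous[OF s] by (simp add: continuous_within)
  then show "((\<lambda>y. max 0 (P y)) \<longlongrightarrow> max 0 (P s)) (at_right s)"
    by (intro tendsto_max tendsto_const)
qed simp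

lemma E_right_deriv:
  assumes "0 \<le> s" "s < 1"
  shows "(E has_real_derivative - P s) (at_right s)"
  using DERIV_minus[OF neg.right_slope_deriv[OF assms]] by simp

lemma S_diff:
  assumes "0 \<le> x" "x \<le> y" "y \<le> 1"
  shows "S x - S y = integral {x..y} (\<lambda>t. P1 t + h t)"
  using Henstock_Kurzweil_Integration.integral_add[OF P1_on h_on, of x y]
    integral_unique[OF P1_has_integral[OF assms]] H_diff[OF assms] assms by simp

lemma P1h_on: "0 \<le> x \<Longrightarrow> y \<le> 1 \<Longrightarrow> (\<lambda>t. P1 t + h t) integrable_on {x..y}"
  by (intro integrable_add P1_on h_on)

text \<open>This is integration by parts without a Stieltjes measure. The function
  \<open>\<Phi> x\<close>, the integral of \<open>\<phi> (P1 + h)\<close> over \<open>[x, 1]\<close> minus \<open>\<phi> x * S x\<close>, is constant: on a short interval \<open>\<phi>\<close> does not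
  change unless \<open>S\<close> is of the order of the increment of \<open>B\<close>, so that the increments of \<open>\<Phi>\<close> are bounded
  by products of increments of \<open>\<phi>\<close> and of the continuous function \<open>B\<close>.\<close>
lemma complementary_slackness: "((\<lambda>t. \<phi> t * (P1 t + h t)) has_integral 0) {0..1}"
proof -
  define \<Phi> where "\<Phi> x = integral {x..1} (\<lambda>t. \<phi> t * (P1 t + h t)) - \<phi> x * S x" for x
  \<comment> \<open>By the second mean value theorem for the monotone \<open>\<phi>\<close>, only
    increments of the slack, split at some \<open>c\<close>, remain of the integral.\<close>
  have mvt: "\<exists>c\<in>{x..y}. ((\<lambda>t. \<phi> t * (P1 t + h t)) has_integral \<phi> x * (S x - S c) + \<phi> y * (S c - S y)) {x..y}"
    if xy: "0 \<le> x" "x \<le> y" "y \<le> 1" for x y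
  proof -
    have mon: "\<And>u v. x \<le> u \<Longrightarrow> u \<le> v \<Longrightarrow> v \<le> y \<Longrightarrow> \<phi> u \<le> \<phi> v" using mono_onD[OF phi_mono] xy by auto
    obtain c where c: "c \<in> {x..y}"
      "((\<lambda>t. \<phi> t * (P1 t + h t)) has_integral (\<phi> x * integral {x..c} (\<lambda>t. P1 t + h t) + \<phi> y * integral {c..y} (\<lambda>t. P1 t + h t))) {x..y}"
      by (rule second_mean_value_theorem_full[OF P1h_on[OF xy(1,3)] xy(2) mon])
    show ?thesis using c S_diff[of x c] S_diff[of c y] xy by (intro bexI[OF _ c(1)]) auto
  qed
  have int: "(\<lambda>t. \<phi> t * (P1 t + h t)) integrable_on {x..y}" if xy: "0 \<le> x" "y \<le> 1" for x y
    using mvt[OF xy(1) _ xy(2)] by (cases "x \<le> y") auto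
  have "\<Phi> 1 = \<Phi> 0"
  \<comment> \<open>The factor 3 adds to the 2 of \<open>slack\<close> another 1 for passing from
    \<open>S y\<close> to \<open>S c\<close>.\<close>
  proof (rule const_if_increment_bound[where D = \<Phi> and a = 0 and b = 1 and A = \<phi> and B = "\<lambda>x. 3 * B x"])
    show "mono_on {0..1} \<phi>" by (rule phi_mono)
    show "continuous_on {0..1} (\<lambda>x. 3 * B x)" using contB by (intro continuous_intros)
    fix x y :: real assume xy: "0 \<le> x" "x \<le> y" "y \<le> 1"
    obtain c where c: "x \<le> c" "c \<le> y"
      "((\<lambda>t. \<phi> t * (P1 t + h t)) has_integral \<phi> x * (S x - S c) + \<phi> y * (S c - S y)) {x..y}"
      using mvt[OF xy] by auto
    have "integral {x..y} (\<lambda>t. \<phi> t * (P1 t + h t)) + integral {y..1} (\<lambda>t. \<phi> t * (P1 t + h t)) =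
      integral {x..1} (\<lambda>t. \<phi> t * (P1 t + h t))"
      by (rule Henstock_Kurzweil_Integration.integral_combine) (use xy int in auto)
    then have eq: "\<Phi> y - \<Phi> x = - ((\<phi> y - \<phi> x) * S c)"
      using integral_unique[OF c(3)] by (simp add: \<Phi>_def algebra_simps)
    have mono: "\<phi> x \<le> \<phi> y" using mono_onD[OF phi_mono] xy by auto
    have Bxy: "0 \<le> B y - B x" using B_mono[OF xy] by simp
    have "\<phi> x = \<phi> y \<or> S c \<le> 3 * (B y - B x)"
    proof -
      have "S c - S y \<le> B y - B x"
        using S_modulus[of c y] B_mono[of x c] c xy by linarith
      moreover have "\<phi> x = \<phi> y \<or> S y \<le> 2 * (B y - B x)"
      proof (cases "y < 1")
        case True then show ?thesis using slack[OF xy(1,2) True] xy by (auto simp: \<phi>_def P1_def)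
      next
        case False then show ?thesis using env_1 xy Bxy by simp
      qed
      ultimately show ?thesis
        by (cases "\<phi> x = \<phi> y") (simp, smt (verit))
    qed
    then have "(\<phi> y - \<phi> x) * S c \<le> (\<phi> y - \<phi> x) * (3 * (B y - B x))"
    proof
      assume "S c \<le> 3 * (B y - B x)"
      then show ?thesis using mono by (intro mult_left_mono) auto
    qed simp
    moreover have "0 \<le> (\<phi> y - \<phi> x) * S c"
      using mono S_nonneg[of c] c xy by (intro mult_nonneg_nonneg) auto
    moreover have "\<bar>3 * B y - 3 * B x\<bar> = 3 * (B y - B x)" using Bxy by simp
    ultimately show "\<bar>\<Phi> y - \<Phi> x\<bar> \<le> (\<phi> y - \<phi> x) * \<bar>3 * B y - 3 * B x\<bar>"
      unfolding eq by simp
  qed simp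
  \<comment> \<open>The boundary terms vanish because the envelope meets \<open>H\<close> at 0 and
    at 1.\<close>
  moreover have "\<Phi> 1 = 0" using env_1 by (simp add: \<Phi>_def)
  moreover have "\<Phi> 0 = integral {0..1} (\<lambda>t. \<phi> t * (P1 t + h t))" using env_0 by (simp add: \<Phi>_def H_def)
  ultimately show ?thesis using int[of 0 1] by (simp add: has_integral_iff)
qed

text \<open>\<open>\<phi>\<close> vanishes wherever it differs from \<open>P1\<close>.\<close>

lemma phi_orthogonal: "((\<lambda>t. \<phi> t * (\<phi> t + h t)) has_integral 0) {0..1}"
proof -
  have "(\<lambda>t. \<phi> t * (\<phi> t + h t)) = (\<lambda>t. \<phi> t * (P1 t + h t))"
    by (rule ext) (auto simp: \<phi>_def max_def)
  then show ?thesis using complementary_slackness by simp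
qed

text \<open>The second mean value theorem replaces \<open>p\<close> by a step function with one
  jump, from \<open>p 0\<close> to \<open>p 1\<close> at \<open>c\<close>. This leaves integrals
  over \<open>{s..1}\<close>, and these are at least \<open>S s - S 1\<close> because
  \<open>\<phi>\<close> dominates \<open>P1\<close>.\<close>

lemma phi_dual_cone:
  fixes p :: "real \<Rightarrow> real"
  assumes p: "mono_on {0..1} p" "0 \<le> p 0"
  shows "(\<lambda>t. p t * (\<phi> t + h t)) integrable_on {0..1}" "0 \<le> integral {0..1} (\<lambda>t. p t * (\<phi> t + h t))"
proof -
  have on: "(\<lambda>t. \<phi> t + h t) integrable_on {x..y}" if "0 \<le> x" "y \<le> 1" for x y
    using that by (intro integrable_add phi_on h_on)
  have mon: "\<And>u v. 0 \<le> u \<Longrightarrow> u \<le> v \<Longrightarrow> v \<le> 1 \<Longrightarrow> p u \<le> p v" using mono_onD[OF p(1)] by auto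
  obtain c where c: "c \<in> {0..1}"
    "((\<lambda>t. p t * (\<phi> t + h t)) has_integral (p 0 * integral {0..c} (\<lambda>t. \<phi> t + h t) + p 1 * integral {c..1} (\<lambda>t. \<phi> t + h t))) {0..1}"
    by (rule second_mean_value_theorem_full[OF on zero_le_one mon]) auto
  have tail: "0 \<le> integral {s..1} (\<lambda>t. \<phi> t + h t)" if s: "0 \<le> s" "s \<le> 1" for s
  proof -
    have "S s - S 1 \<le> integral {s..1} (\<lambda>t. \<phi> t + h t)"
      unfolding S_diff[OF s order_refl]
      by (rule integral_le[OF P1h_on on]) (use s in \<open>auto simp: \<phi>_def\<close>)
    then show ?thesis using S_nonneg[OF s] env_1 by simp
  qed
  have "integral {0..c} (\<lambda>t. \<phi> t + h t) = integral {0..1} (\<lambda>t. \<phi> t + h t) - integral {c..1} (\<lambda>t. \<phi> t + h t)"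
    using Henstock_Kurzweil_Integration.integral_combine[OF _ _ on, of 0 c 1] c(1) by auto
  then have "p 0 * integral {0..c} (\<lambda>t. \<phi> t + h t) + p 1 * integral {c..1} (\<lambda>t. \<phi> t + h t) =
    p 0 * integral {0..1} (\<lambda>t. \<phi> t + h t) + (p 1 - p 0) * integral {c..1} (\<lambda>t. \<phi> t + h t)"
    by (simp only: right_diff_distrib left_diff_distrib)
  also have "\<dots> \<ge> 0"
    using p(2) mon[of 0 1] tail[of 0] tail[of c] c(1) by (intro add_nonneg_nonneg mult_nonneg_nonneg) auto
  finally show "0 \<le> integral {0..1} (\<lambda>t. p t * (\<phi> t + h t))" using integral_unique[OF c(2)] by simp
  show "(\<lambda>t. p t * (\<phi> t + h t)) integrable_on {0..1}" using c(2) by (rule has_integral_integrable)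
qed

end

section \<open>Stieltjes integrals against convex functions\<close>

abbreviation unit_lborel :: "real measure" where
  "unit_lborel \<equiv> restrict_space lborel {0<..<1}"

lemma prob_space_unit_lborel: "prob_space unit_lborel"
  by (auto simp: emeasure_restrict_space space_restrict_space intro!: prob_spaceI)

interpretation unit: prob_space unit_lborel by (rule prob_space_unit_lborel)

lemma unit_space[simp]: "space unit_lborel = {0<..<1}"
  by (simp add: space_restrict_space)

lemma measurable_unit_mono:
  fixes f :: "real \<Rightarrow> real"
  assumes "mono_on {0<..<1} f"
  shows "f \<in> borel_measurable unit_lborel"
proof -
  have "f \<in> borel_measurable (restrict_space borel {0<..<1})" by (rule borel_measurable_mono_on_fnc[OF assms])
  then show ?thesis by (simp cong: measurable_cong_sets sets_restrict_space_cong)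
qed

lemma measurable_unit_iff:
  "f \<in> borel_measurable unit_lborel \<longleftrightarrow> (\<lambda>x. indicator {0<..<1} x *\<^sub>R f x :: real) \<in> borel_measurable borel"
  by (subst borel_measurable_restrict_space_iff) auto

lemma integrable_unit_iff:
  fixes f :: "real \<Rightarrow> real"
  assumes "{0<..<1} \<subseteq> A" "A \<subseteq> {0..1}"
  shows "integrable unit_lborel f \<longleftrightarrow> set_integrable lborel A f"
  unfolding set_integrable_def
  by (subst integrable_restrict_space; simp) (rule integrable_discrete_difference[where X = "{0, 1}"],
    use assms in \<open>auto simp: indicator_def\<close>)

lemma integral_unit_eq:
  fixes f :: "real \<Rightarrow> real"
  assumes "{0<..<1} \<subseteq> A" "A \<subseteq> {0..1}"
  shows "(LINT x:A|lborel. f x) = (LINT x|unit_lborel. f x)"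
  unfolding set_lebesgue_integral_def
  by (subst integral_restrict_space; simp) (rule integral_discrete_difference[where X = "{0, 1}"],
    use assms in \<open>auto simp: indicator_def\<close>)

lemma unit_integrable_absolutely:
  fixes f :: "real \<Rightarrow> real"
  assumes "integrable unit_lborel f"
  shows "f absolutely_integrable_on {0..1}"
proof -
  have "set_integrable lborel {0..1} f"
    by (rule integrable_unit_iff[THEN iffD1, OF _ _ assms]) auto
  then show ?thesis
    unfolding set_integrable_def using integrable_completion borel_measurable_integrable by blast
qed

lemma unit_integral_eq_HK:
  fixes f :: "real \<Rightarrow> real"
  assumes "integrable unit_lborel f"
  shows "(LINT x|unit_lborel. f x) = integral {0..1} f"
proof -
  have "set_integrable lborel {0..1} f"
    by (rule integrable_unit_iff[THEN iffD1, OF _ _ assms]) auto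
  from set_borel_integral_eq_integral(2)[OF this] show ?thesis
    using integral_unit_eq[OF _ order_refl, of f] by (simp add: subset_eq)
qed

lemma unit_AE_countable: "countable A \<Longrightarrow> AE x in unit_lborel. x \<notin> A"
  using AE_not_in[OF countable_imp_null_set_lborel, of A]
  by (subst AE_restrict_space_iff) (auto elim: eventually_mono)

section \<open>Square integrable functions and monotone versions\<close>

lemma integrable_mult_square:
  fixes f g :: "'a \<Rightarrow> real"
  assumes [measurable]: "f \<in> borel_measurable M" "g \<in> borel_measurable M"
    and "integrable M (\<lambda>x. (f x)\<^sup>2)" "integrable M (\<lambda>x. (g x)\<^sup>2)"
  shows "integrable M (\<lambda>x. f x * g x)"
proof (rule Bochner_Integration.integrable_bound)
  show "integrable M (\<lambda>x. (f x)\<^sup>2 + (g x)\<^sup>2)" using assms by simp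
  show "AE x in M. norm (f x * g x) \<le> norm ((f x)\<^sup>2 + (g x)\<^sup>2)"
  proof (rule AE_I2)
    fix x
    have "2 * \<bar>f x\<bar> * \<bar>g x\<bar> \<le> \<bar>f x\<bar>\<^sup>2 + \<bar>g x\<bar>\<^sup>2" by (rule sum_squares_bound)
    moreover have "0 \<le> \<bar>f x\<bar> * \<bar>g x\<bar>" by simp
    moreover have "\<bar>(f x)\<^sup>2 + (g x)\<^sup>2\<bar> = (f x)\<^sup>2 + (g x)\<^sup>2" by simp
    ultimately show "norm (f x * g x) \<le> norm ((f x)\<^sup>2 + (g x)\<^sup>2)"
      unfolding real_norm_def abs_mult power2_abs by linarith
  qed
qed simp

lemma integrable_square_add:
  fixes f g :: "'a \<Rightarrow> real"
  assumes [measurable]: "f \<in> borel_measurable M" "g \<in> borel_measurable M"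
    and "integrable M (\<lambda>x. (f x)\<^sup>2)" "integrable M (\<lambda>x. (g x)\<^sup>2)"
  shows "integrable M (\<lambda>x. (f x + g x)\<^sup>2)"
  using integrable_mult_square[OF assms] assms(3,4)
  by (simp add: power2_sum mult.assoc)

text \<open>\<open>Qset\<close> demands right continuity, which the pointwise minimiser of the
  Lagrangian may lack. Taking right limits changes a monotone function only at its countably many
  discontinuities. The lower bound \<open>c\<close> makes the infimum at \<open>s = 0\<close>
  meaningful.\<close>

lemma right_continuous_version:
  fixes g :: "real \<Rightarrow> real"
  assumes g: "mono_on {0<..<1} g" and lb: "\<And>x. 0 < x \<Longrightarrow> x < 1 \<Longrightarrow> c \<le> g x"
  obtains Q where "mono_on {0..<1} Q" "\<And>s. 0 \<le> s \<Longrightarrow> s < 1 \<Longrightarrow> continuous (at_right s) Q"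
    "AE x in unit_lborel. Q x = g x"
proof
  define Q where "Q s = Inf (g ` {s<..<1})" for s
  have bdd: "bdd_below (g ` {s<..<1})" if "0 \<le> s" for s
    by (rule bdd_belowI[of _ c]) (use lb that in auto)
  have Q_le: "Q s \<le> g t" if "0 \<le> s" "s < t" "t < 1" for s t
    unfolding Q_def by (rule cINF_lower[OF bdd]) (use that in auto)
  have Q_ge: "d \<le> Q s" if "s < 1" "\<And>t. s < t \<Longrightarrow> t < 1 \<Longrightarrow> d \<le> g t" for d s
    unfolding Q_def by (rule cINF_greatest) (use that in auto)
  show mono: "mono_on {0..<1} Q"
    by (rule mono_onI, rule Q_ge) (auto intro!: Q_le)
  show "continuous (at_right s) Q" if s: "0 \<le> s" "s < 1" for s
    unfolding continuous_within
  proof (rule order_tendstoI)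
    fix d assume d: "d < Q s"
    have "eventually (\<lambda>y. y \<in> {s<..<1}) (at_right s)" by (rule eventually_at_right_real[OF s(2)])
    then show "eventually (\<lambda>y. d < Q y) (at_right s)"
    proof eventually_elim
      case (elim y)
      then show ?case using mono_onD[OF mono, of s y] s d by auto
    qed
  next
    fix d assume d: "Q s < d"
    then obtain t where t: "s < t" "t < 1" "g t < d"
      using Q_ge[OF s(2), of d] by force
    have "eventually (\<lambda>y. y \<in> {s<..<t}) (at_right s)" by (rule eventually_at_right_real[OF t(1)])
    then show "eventually (\<lambda>y. Q y < d) (at_right s)"
    proof eventually_elim
      case (elim y)
      then show ?case using Q_le[of y t] s t by auto
    qed
  qed
  have "Q x = g x" if x: "0 < x" "x < 1" "isCont g x" for x
  proof (rule antisym)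
    show "g x \<le> Q x" by (rule Q_ge) (use x mono_onD[OF g, of x] in auto)
    have "(g \<longlongrightarrow> g x) (at_right x)"
      using x(3) by (auto simp: isCont_def intro: tendsto_within_subset)
    moreover have "eventually (\<lambda>y. Q x \<le> g y) (at_right x)"
    proof -
      have "eventually (\<lambda>y. y \<in> {x<..<1}) (at_right x)" by (rule eventually_at_right_real[OF x(2)])
      then show ?thesis by eventually_elim (use Q_le[of x] x in auto)
    qed
    ultimately show "Q x \<le> g x" by (rule tendsto_lowerbound) simp
  qed
  moreover have "AE x in unit_lborel. x \<notin> {a \<in> {0<..<1}. \<not> isCont g a}"
    by (rule unit_AE_countable[OF mono_on_ctble_discont_open[OF _ g]]) simp
  moreover have "AE x in unit_lborel. x \<in> {0<..<1}"
    by (metis AE_space unit_space)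
  ultimately show "AE x in unit_lborel. Q x = g x" by (auto elim!: AE_mp)
qed

section \<open>The Stieltjes measure of a convex function\<close>

abbreviation clamp01 :: "real \<Rightarrow> real" where
  "clamp01 x \<equiv> max 0 (min 1 x)"

lemma WicxD:
  assumes "v \<in> Wicx"
  shows "mono_on {0..1} v" "convex_on {0..1} v" "v 0 = 0" "\<And>x. 0 \<le> x \<Longrightarrow> x \<le> 1 \<Longrightarrow> 0 \<le> v x"
  using assms by (auto simp: Wicx_def)

lemma Wicx_convex_lower_lipschitz: "v \<in> Wicx \<Longrightarrow> convex_lower_lipschitz v 0"
  by standard (use WicxD mono_onD[of "{0..1}" v] in auto)

lemma Wicx_clamp_mono: "v \<in> Wicx \<Longrightarrow> x \<le> y \<Longrightarrow> v (clamp01 x) \<le> v (clamp01 y)"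
  by (rule mono_onD[OF WicxD(1)]) auto

lemma Wicx_clamp_right_continuous:
  assumes v: "v \<in> Wicx"
  shows "continuous (at_right a) (\<lambda>x. v (clamp01 x))"
proof -
  interpret convex_lower_lipschitz v 0 by (rule Wicx_convex_lower_lipschitz[OF v])
  consider "a < 0" | "0 \<le> a" "a < 1" | "1 \<le> a" by linarith
  then show ?thesis
  proof cases
    case 1
    have "eventually (\<lambda>x. x \<in> {a<..<0}) (at_right a)" by (rule eventually_at_right_real[OF 1])
    then have "eventually (\<lambda>x. v (clamp01 x) = v (clamp01 a)) (at_right a)"
      by eventually_elim (use 1 in auto)
    then show ?thesis unfolding continuous_within by (rule tendsto_eventually)
  next
    case 2
    have "(v \<longlongrightarrow> v a) (at_right a)"
      using DERIV_continuous[OF right_slope_deriv[OF 2]] by (simp add: continuous_within)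
    moreover have "eventually (\<lambda>x. v x = v (clamp01 x)) (at_right a)"
    proof -
      have "eventually (\<lambda>x. x \<in> {a<..<1}) (at_right a)" by (rule eventually_at_right_real[OF 2(2)])
      then show ?thesis by eventually_elim (use 2 in auto)
    qed
    ultimately have "((\<lambda>x. v (clamp01 x)) \<longlongrightarrow> v a) (at_right a)" by (rule Lim_transform_eventually)
    then show ?thesis using 2 by (simp add: continuous_within)
  next
    case 3
    have "eventually (\<lambda>x. x \<in> {a<..<a+1}) (at_right a)" by (rule eventually_at_right_real) simp
    then have "eventually (\<lambda>x. v (clamp01 x) = v (clamp01 a)) (at_right a)"
      by eventually_elim (use 3 in auto)
    then show ?thesis unfolding continuous_within by (rule tendsto_eventually)
  qed
qed

lemma emeasure_stieltjes_Ioc: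
  assumes "v \<in> Wicx" "a \<le> b"
  shows "emeasure (stieltjes v) {a<..b} = ennreal (v (clamp01 b) - v (clamp01 a))"
  unfolding stieltjes_def
  by (rule emeasure_interval_measure_Ioc[OF assms(2) Wicx_clamp_mono[OF assms(1)] Wicx_clamp_right_continuous[OF assms(1)]])

lemma sets_stieltjes[simp, measurable_cong]: "sets (stieltjes v) = sets borel"
  by (simp add: stieltjes_def)

lemma space_stieltjes[simp]: "space (stieltjes v) = UNIV"
  by (simp add: stieltjes_def)

text \<open>A Borel measure that is finite on the half lines \<open>{a<..}\<close> is determined by
  them, so this formula serves to identify \<open>stieltjes v\<close>.\<close>

lemma emeasure_stieltjes_Ioi:
  assumes v: "v \<in> Wicx"
  shows "emeasure (stieltjes v) {a<..} = ennreal (v 1 - v (clamp01 a))"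
proof -
  have "(\<lambda>n. emeasure (stieltjes v) {a<..a + real n}) \<longlonglongrightarrow> emeasure (stieltjes v) (\<Union>n. {a<..a + real n})"
    by (rule Lim_emeasure_incseq) (auto simp: incseq_def)
  also have "(\<Union>n. {a<..a + real n}) = {a<..}"
    by (auto, metis add.commute diff_le_eq real_arch_simple)
  finally have 1: "(\<lambda>n. emeasure (stieltjes v) {a<..a + real n}) \<longlonglongrightarrow> emeasure (stieltjes v) {a<..}" .
  obtain n0 where n0: "1 - a < real n0" using reals_Archimedean2 by blast
  have "eventually (\<lambda>n. emeasure (stieltjes v) {a<..a + real n} = ennreal (v 1 - v (clamp01 a))) sequentially"
    using eventually_ge_at_top[of n0]
  proof eventually_elim
    case (elim n)
    then have "real n0 \<le> real n" by simp
    then have "1 < a + real n" using n0 by linarith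
    then show ?case using emeasure_stieltjes_Ioc[OF v, of a "a + real n"] by (simp add: min_def max_def)
  qed
  then have "(\<lambda>n. emeasure (stieltjes v) {a<..a + real n}) \<longlonglongrightarrow> ennreal (v 1 - v (clamp01 a))"
    by (rule tendsto_eventually)
  then show ?thesis using 1 LIMSEQ_unique by blast
qed

text \<open>The integrals stop at \<open>b < 1\<close> because \<open>p\<close> may be unbounded
  near 1. Continuity of \<open>v\<close> at 1 excludes an atom there, so that \<open>p\<close> is a
  density of the whole Stieltjes measure.\<close>

locale Wicx_density =
  fixes v p :: "real \<Rightarrow> real"
  assumes v: "v \<in> Wicx" and v_cont: "continuous_on {0..1} v"
    and p_mono: "mono_on {0..<1} p" and p_nonneg: "\<And>x. 0 \<le> x \<Longrightarrow> x < 1 \<Longrightarrow> 0 \<le> p x"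
    and p_int: "\<And>a b. 0 \<le> a \<Longrightarrow> a \<le> b \<Longrightarrow> b < 1 \<Longrightarrow> (p has_integral v b - v a) {a..b}"
begin

definition "\<nu> = density lborel (\<lambda>x. indicator {0<..<1} x * ennreal (p x))"

lemma p_meas[measurable]: "p \<in> borel_measurable unit_lborel"
  by (rule measurable_unit_mono) (use p_mono in \<open>auto simp: mono_on_def\<close>)

lemma dens_meas[measurable]: "(\<lambda>x. indicator {0<..<1} x * ennreal (p x)) \<in> borel_measurable borel"
proof -
  have "(\<lambda>x. ennreal (indicator {0<..<1} x *\<^sub>R p x)) \<in> borel_measurable borel"
    using p_meas by (simp add: measurable_unit_iff)
  also have "(\<lambda>x. ennreal (indicator {0<..<1} x *\<^sub>R p x)) = (\<lambda>x. indicator {0<..<1} x * ennreal (p x))"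
    by (auto simp: indicator_def)
  finally show ?thesis .
qed

lemma nu_Ioc:
  assumes "0 \<le> a" "a \<le> b" "b < 1"
  shows "emeasure \<nu> {a<..b} = ennreal (v b - v a)"
proof -
  have "emeasure \<nu> {a<..b} = (\<integral>\<^sup>+x. indicator {0<..<1} x * ennreal (p x) * indicator {a<..b} x \<partial>lborel)"
    unfolding \<nu>_def by (rule emeasure_density) auto
  also have "\<dots> = (\<integral>\<^sup>+x. indicator {a..b} x * ennreal (p x) \<partial>lborel)"
  proof (rule nn_integral_cong_AE)
    have "AE x in lborel. x \<noteq> a" by (rule AE_lborel_singleton)
    then show "AE x in lborel. indicator {0<..<1} x * ennreal (p x) * indicator {a<..b} x = indicator {a..b} x * ennreal (p x)"
      by eventually_elim (use assms in \<open>auto simp: indicator_def\<close>)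
  qed
  also have "\<dots> = (\<integral>\<^sup>+x. indicator {a..b} x * p x \<partial>lborel)"
    by (rule nn_integral_cong) (auto simp: indicator_def)
  also have "\<dots> = ennreal (v b - v a)"
    by (rule nn_integral_has_integral_lebesgue) (use assms p_nonneg p_int in auto)
  finally show ?thesis .
qed

lemma nu_Ioi: "emeasure \<nu> {a<..} = ennreal (v 1 - v (clamp01 a))"
proof -
  define u where "u = clamp01 a"
  have u: "0 \<le> u" "u \<le> 1" by (auto simp: u_def)
  have e: "emeasure \<nu> {a<..} = emeasure \<nu> {u<..<1}"
  proof -
    have "indicator {0<..<1} x * ennreal (p x) * indicator {a<..} x = indicator {0<..<1} x * ennreal (p x) * indicator {u<..<1} x" for x
      by (auto simp: u_def indicator_def)
    then show ?thesis
      unfolding \<nu>_def by (subst (1 2) emeasure_density) auto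
  qed
  show ?thesis
  proof (cases "u = 1")
    case True then show ?thesis using e by (simp add: u_def[symmetric])
  next
    case False
    then have u1: "u < 1" using u by simp
    \<comment> \<open>These points increase from \<open>b 0 = u\<close> to 1 without reaching it, as
      \<open>nu_Ioc\<close> requires.\<close>
    define b where "b n = 1 - (1 - u) / real (Suc n)" for n
    have b: "u \<le> b n" "b n < 1" for n
    proof -
      have "(1 - u) / real (Suc n) \<le> (1 - u) / 1" using u1 by (intro divide_left_mono) auto
      then show "u \<le> b n" by (simp add: b_def)
      show "b n < 1" using u1 by (simp add: b_def)
    qed
    have b_lim: "b \<longlonglongrightarrow> 1"
      unfolding b_def using tendsto_diff[OF tendsto_const LIMSEQ_Suc[OF lim_const_over_n[of "1 - u"]], of 1]
      by simp
    have b_mono: "b m \<le> b n" if "m \<le> n" for m n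
      unfolding b_def using that u1 by (intro diff_left_mono divide_left_mono) auto
    have "(\<lambda>n. emeasure \<nu> {u<..b n}) \<longlonglongrightarrow> emeasure \<nu> (\<Union>n. {u<..b n})"
      by (rule Lim_emeasure_incseq) (auto simp: incseq_def \<nu>_def dest: order_trans[OF _ b_mono])
    also have "(\<Union>n. {u<..b n}) = {u<..<1}"
    proof (intro set_eqI iffI)
      fix x assume x: "x \<in> {u<..<1}"
      then have "eventually (\<lambda>n. x < b n) sequentially" using order_tendstoD(1)[OF b_lim, of x] by simp
      then obtain n where "x < b n" by (auto simp: eventually_sequentially)
      then show "x \<in> (\<Union>n. {u<..b n})" using x by (intro UN_I[of n]) auto
    qed (use b(2) in \<open>auto intro: le_less_trans\<close>)
    finally have 1: "(\<lambda>n. ennreal (v (b n) - v u)) \<longlonglongrightarrow> emeasure \<nu> {u<..<1}"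
      using nu_Ioc[OF u(1) b] by simp
    have "0 \<le> b n" "b n \<le> 1" for n using b[of n] u by auto
    then have "(\<lambda>n. v (b n)) \<longlonglongrightarrow> v 1"
      by (intro continuous_on_tendsto_compose[OF v_cont b_lim]) auto
    then have "(\<lambda>n. ennreal (v (b n) - v u)) \<longlonglongrightarrow> ennreal (v 1 - v u)"
      by (intro tendsto_ennrealI tendsto_diff tendsto_const)
    from LIMSEQ_unique[OF 1 this] show ?thesis using e by (simp add: u_def)
  qed
qed

lemma stieltjes_eq_density: "stieltjes v = \<nu>"
  by (rule measure_eqI_lessThan) (auto simp: emeasure_stieltjes_Ioi[OF v] nu_Ioi, auto simp: \<nu>_def)

text \<open>\<open>g\<close> is prescribed on the open interval only: for an unbounded
  \<open>Q\<close> the value of \<open>Qbar\<close> at 1 is infinite, but the measure has no mass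
  there.\<close>

lemma nn_integral_stieltjes:
  fixes g :: "real \<Rightarrow> ennreal"
  assumes r: "r \<in> borel_measurable unit_lborel" and g: "\<And>x. 0 < x \<Longrightarrow> x < 1 \<Longrightarrow> g x = ennreal (r x)"
  shows "(\<integral>\<^sup>+x. g x * indicator {0..1} x \<partial>stieltjes v) = (\<integral>\<^sup>+x. ennreal (r x * p x) \<partial>unit_lborel)"
proof -
  have m: "(\<lambda>x. g x * indicator {0..1} x) \<in> borel_measurable borel"
  proof (rule measurable_discrete_difference[where X = "{0, 1}"])
    show "(\<lambda>x. ennreal (indicator {0<..<1} x *\<^sub>R r x)) \<in> borel_measurable borel"
      using r by (simp add: measurable_unit_iff)
  qed (auto simp: g indicator_def)
  have "(\<integral>\<^sup>+x. g x * indicator {0..1} x \<partial>stieltjes v) =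
    (\<integral>\<^sup>+x. (indicator {0<..<1} x * ennreal (p x)) * (g x * indicator {0..1} x) \<partial>lborel)"
    unfolding stieltjes_eq_density \<nu>_def by (rule nn_integral_density) (use m in auto)
  also have "\<dots> = (\<integral>\<^sup>+x. ennreal (r x * p x) * indicator {0<..<1} x \<partial>lborel)"
    by (rule nn_integral_cong) (auto simp: indicator_def g ennreal_mult' ennreal_mult'' p_nonneg mult.commute)
  also have "\<dots> = (\<integral>\<^sup>+x. ennreal (r x * p x) \<partial>unit_lborel)"
    by (subst nn_integral_restrict_space) auto
  finally show ?thesis .
qed

lemma int_dw_eq:
  assumes Q: "Q \<in> borel_measurable unit_lborel" and int: "integrable unit_lborel (\<lambda>x. Q x * p x)"
  shows "int_dw Q v = ereal (LINT x|unit_lborel. Q x * p x)"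
proof -
  have 1: "(\<integral>\<^sup>+x. e2ennreal (Qbar Q x) * indicator {0..1} x \<partial>stieltjes v) = (\<integral>\<^sup>+x. ennreal (Q x * p x) \<partial>unit_lborel)"
    by (rule nn_integral_stieltjes[OF Q]) (simp add: Qbar_def)
  have 2: "(\<integral>\<^sup>+x. e2ennreal (- Qbar Q x) * indicator {0..1} x \<partial>stieltjes v) = (\<integral>\<^sup>+x. ennreal (- Q x * p x) \<partial>unit_lborel)"
    by (rule nn_integral_stieltjes) (use Q in \<open>auto simp: Qbar_def\<close>)
  have f: "(\<integral>\<^sup>+x. ennreal (Q x * p x) \<partial>unit_lborel) < \<infinity>" "(\<integral>\<^sup>+x. ennreal (- (Q x * p x)) \<partial>unit_lborel) < \<infinity>"
    using int by (auto simp: real_integrable_def less_top)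
  have e: "enn2ereal x = ereal (enn2real x)" if "x < \<infinity>" for x
    using that by (cases x) (auto simp: enn2ereal_ennreal)
  show ?thesis
    unfolding int_dw_def 1 2 using e[OF f(1)] e[OF f(2)] real_lebesgue_integral_def[OF int] by simp
qed

text \<open>The integral of \<open>p\<close> is bounded by the total mass
  \<open>v 1 - v 0\<close>.\<close>

lemma p_integrable: "integrable unit_lborel p"
proof (rule integrableI_nonneg)
  have "(\<integral>\<^sup>+x. 1 * indicator {0..1} x \<partial>stieltjes v) = (\<integral>\<^sup>+x. ennreal (1 * p x) \<partial>unit_lborel)"
    by (rule nn_integral_stieltjes) auto
  moreover have "(\<integral>\<^sup>+x. 1 * indicator {0..1::real} x \<partial>stieltjes v) \<le> emeasure (stieltjes v) {-1<..}"
    by (simp add: emeasure_mono subset_eq)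
  ultimately show "(\<integral>\<^sup>+x. ennreal (p x) \<partial>unit_lborel) < \<infinity>"
    using emeasure_stieltjes_Ioi[OF v, of "-1"] by (auto intro: order_le_less_trans simp: ennreal_less_top)
qed (use p_nonneg in auto)

end

section \<open>The dual objective\<close>

lemma unit_integrable_reflect:
  fixes f :: "real \<Rightarrow> real"
  assumes "integrable unit_lborel f"
  shows "integrable unit_lborel (\<lambda>s. f (1 - s))"
proof -
  have "integrable lborel (\<lambda>x. indicator {0<..<1} x *\<^sub>R f x)"
    using assms by (subst (asm) integrable_restrict_space) auto
  from lborel_integrable_real_affine[OF this, of "-1" 1]
  have "integrable lborel (\<lambda>x. indicator {0<..<1} (1 - x) *\<^sub>R f (1 - x))" by simp
  also have "(\<lambda>x. indicator {0<..<1} (1 - x) *\<^sub>R f (1 - x)) = (\<lambda>x. indicator {0<..<1} x *\<^sub>R f (1 - x))"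
    by (auto simp: indicator_def)
  finally show ?thesis by (subst integrable_restrict_space) auto
qed

lemma QsetD:
  assumes "Q \<in> Qset"
  shows "Q \<in> borel_measurable unit_lborel" "integrable unit_lborel (\<lambda>s. (Q s)\<^sup>2)"
    "integrable unit_lborel Q"
proof -
  show 1: "Q \<in> borel_measurable unit_lborel"
    by (rule measurable_unit_mono) (use assms in \<open>auto simp: Qset_def mono_on_def\<close>)
  show 2: "integrable unit_lborel (\<lambda>s. (Q s)\<^sup>2)"
    by (rule integrable_unit_iff[THEN iffD2, of "{0..<1}"]) (use assms in \<open>auto simp: Qset_def\<close>)
  show "integrable unit_lborel Q" by (rule unit.square_integrable_imp_integrable[OF 1 2])
qed

lemma QsetI:
  assumes "mono_on {0..<1} Q" "\<And>s. 0 \<le> s \<Longrightarrow> s < 1 \<Longrightarrow> continuous (at_right s) Q"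
    "integrable unit_lborel (\<lambda>s. (Q s)\<^sup>2)"
  shows "Q \<in> Qset"
proof -
  have "set_integrable lborel {0..<1} (\<lambda>s. (Q s)\<^sup>2)"
    by (rule integrable_unit_iff[THEN iffD1, OF _ _ assms(3)]) auto
  then show ?thesis using assms by (auto simp: Qset_def)
qed

section \<open>The Lagrangian as a quadratic functional\<close>

locale sdf_dual =
  fixes R Q0 :: "real \<Rightarrow> real" and \<beta> lam C :: real
  assumes R_mono: "mono_on {0<..<1} R" and R_sq: "integrable unit_lborel (\<lambda>s. (R s)\<^sup>2)"
    and R_nonneg: "\<And>s. 0 < s \<Longrightarrow> s < 1 \<Longrightarrow> 0 \<le> R s"
    and lam: "0 < lam"
    and Q0_mono: "mono_on {0..<1} Q0" and Q0_bound: "\<And>s. 0 \<le> s \<Longrightarrow> s < 1 \<Longrightarrow> \<bar>Q0 s\<bar> \<le> C"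
begin

text \<open>\<open>R\<close> is controlled on the open interval only. The default 0 makes the bounds
  below hold at the end points as well.\<close>

definition "a s = (if s \<in> {0<..<1} then \<beta> - lam * R (1 - s) / 2 else 0)"
definition "q s = (if s \<in> {0<..<1} then Q0 s else 0)"
text \<open>Twice the sum of the bounds on \<open>a\<close> over the right half of the interval and
  on \<open>q\<close>. For \<open>1 / 2 \<le> s < 1\<close> monotonicity gives
  \<open>R (1 - s) \<le> R (1 / 2)\<close>.\<close>

definition "K = 2 * \<bar>\<beta>\<bar> + 2 * C + lam * R (1 / 2)"
definition "h s = 2 * a s - 2 * q s"

lemma C0: "0 \<le> C" using Q0_bound[of 0] by simp

lemma a_mono: "mono_on {0<..<1} a"
proof (rule mono_onI)
  fix x y :: real assume xy: "x \<in> {0<..<1}" "y \<in> {0<..<1}" "x \<le> y"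
  have "R (1 - y) \<le> R (1 - x)" by (rule mono_onD[OF R_mono]) (use xy in auto)
  then show "a x \<le> a y" using xy lam by (simp add: a_def mult_left_mono)
qed

lemma a_meas[measurable]: "a \<in> borel_measurable unit_lborel"
  by (rule measurable_unit_mono[OF a_mono])

lemma q_meas[measurable]: "q \<in> borel_measurable unit_lborel"
  by (rule measurable_unit_mono) (use Q0_mono in \<open>auto simp: mono_on_def q_def\<close>)

lemma R_meas: "(\<lambda>s. R (1 - s)) \<in> borel_measurable unit_lborel"
proof -
  have "mono_on {0<..<1} (\<lambda>s. - R (1 - s))"
    by (rule mono_onI) (use R_mono in \<open>auto simp: mono_on_def\<close>)
  from measurable_unit_mono[OF this] show ?thesis by simp
qed

lemma R_refl_sq: "integrable unit_lborel (\<lambda>s. (R (1 - s))\<^sup>2)"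
  by (rule unit_integrable_reflect[OF R_sq])

lemma R_refl: "integrable unit_lborel (\<lambda>s. R (1 - s))"
  by (rule unit.square_integrable_imp_integrable[OF R_meas R_refl_sq])

lemma a_sq: "integrable unit_lborel (\<lambda>s. (a s)\<^sup>2)"
proof -
  have "integrable unit_lborel (\<lambda>s. \<beta>\<^sup>2 - (\<beta> * lam) * R (1 - s) + (lam\<^sup>2 / 4) * (R (1 - s))\<^sup>2)"
    using R_refl R_refl_sq by simp
  also have "?this \<longleftrightarrow> ?thesis"
    by (rule Bochner_Integration.integrable_cong) (auto simp: a_def power2_eq_square algebra_simps)
  finally show ?thesis .
qed

lemma a_integrable: "integrable unit_lborel a"
  by (rule unit.square_integrable_imp_integrable[OF a_meas a_sq])

lemma q_bound: "\<bar>q s\<bar> \<le> C"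
  using Q0_bound[of s] C0 by (auto simp: q_def)

lemma q_integrable: "integrable unit_lborel q"
  by (rule unit.integrable_const_bound[of _ C]) (use q_bound in auto)

lemma q_sq: "integrable unit_lborel (\<lambda>s. (q s)\<^sup>2)"
  by (rule unit.integrable_const_bound[of _ "C\<^sup>2"]) (use q_bound C0 in \<open>auto simp: abs_le_square_iff[symmetric]\<close>)

lemma a_upper: "a s \<le> \<bar>\<beta>\<bar>"
  using R_nonneg[of "1 - s"] lam by (auto simp: a_def intro: order_trans[of _ "\<beta>"])

lemma a_lower: "1 / 2 \<le> s \<Longrightarrow> - \<bar>\<beta>\<bar> - lam * R (1 / 2) / 2 \<le> a s"
proof -
  assume s: "1 / 2 \<le> s"
  have R0: "0 \<le> lam * R (1 / 2)" using R_nonneg[of "1/2"] lam by simp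
  show ?thesis
  proof (cases "s < 1")
    case True
    then have "R (1 - s) \<le> R (1 / 2)" using mono_onD[OF R_mono, of "1 - s" "1 / 2"] s by auto
    then have "lam * R (1 - s) \<le> lam * R (1 / 2)" using lam by simp
    then show ?thesis using True s by (simp add: a_def)
  next
    case False then show ?thesis using R0 by (simp add: a_def)
  qed
qed

sublocale isotonic h K
proof
  have "integrable unit_lborel h"
    unfolding h_def using a_integrable q_integrable by simp
  then show "h absolutely_integrable_on {0..1}" by (rule unit_integrable_absolutely)
  have R0: "0 \<le> lam * R (1 / 2)" using R_nonneg[of "1/2"] lam by simp
  show "0 \<le> K" using R0 C0 by (simp add: K_def)
  fix s :: real
  show "h s \<le> K" using a_upper[of s] q_bound[of s] R0 by (simp add: h_def K_def abs_le_iff)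
  assume "1 / 2 \<le> s"
  then show "- K \<le> h s" using a_lower[of s] q_bound[of s] R0 by (simp add: h_def K_def abs_le_iff)
qed

lemma h_integrable: "integrable unit_lborel h"
  unfolding h_def using a_integrable q_integrable by simp

lemma phi_bounded: "0 < s \<Longrightarrow> s < 1 \<Longrightarrow> \<bar>\<phi> s\<bar> \<le> K + 2 * M"
  using phi_nonneg[of s] phi_le[of s] by auto

lemma phi_meas[measurable]: "\<phi> \<in> borel_measurable unit_lborel"
  by (rule measurable_unit_mono) (use phi_mono in \<open>auto simp: mono_on_def\<close>)

lemma phi_integrable: "integrable unit_lborel \<phi>"
  by (rule unit.integrable_const_bound[of _ "K + 2 * M"]) (use phi_bounded in auto)

lemma phi_sq: "integrable unit_lborel (\<lambda>s. (\<phi> s)\<^sup>2)"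
  by (rule unit.integrable_const_bound[of _ "(K + 2 * M)\<^sup>2"])
    (auto intro!: AE_I2 simp: abs_le_square_iff[symmetric] intro: order_trans[OF phi_bounded])

lemma W_density: "Wicx_density W \<phi>"
proof
  show "W \<in> Wicx" by (rule W_Wicx)
  show "continuous_on {0..1} W" by (rule W_cont)
  show "mono_on {0..<1} \<phi>" using phi_mono by (auto simp: mono_on_def)
  show "0 \<le> \<phi> x" for x by (rule phi_nonneg)
  fix x y :: real assume "0 \<le> x" "x \<le> y" "y < 1"
  then show "(\<phi> has_integral W y - W x) {x..y}"
    using W_diff[of x y] phi_on[of x y] by (simp add: has_integral_iff)
qed

text \<open>The Lagrangian with the infimum over \<open>Q\<close> taken inside the integral: the
  integrand is the minimum of \<open>x\<^sup>2 - 2 * a s * x + \<beta>\<^sup>2 - x * p s + q s * p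
  s\<close>, attained at \<open>x = a s + p s / 2\<close>.\<close>

definition "J p = (LINT s|unit_lborel. \<beta>\<^sup>2 - (a s + p s / 2)\<^sup>2 + q s * p s)"

lemma quadratic_part:
  assumes Q: "Q \<in> Qset"
  shows "(LINT s:{0..<1}|lborel. (Q s - \<beta>)\<^sup>2) + lam * (LINT s:{0..<1}|lborel. Q s * R (1 - s)) =
    (LINT s|unit_lborel. (Q s)\<^sup>2 - 2 * a s * Q s + \<beta>\<^sup>2)"
proof -
  note D = QsetD[OF Q]
  have s: "{0<..<1::real} \<subseteq> {0..<1}" "{0..<1::real} \<subseteq> {0..1}" by auto
  have QR: "integrable unit_lborel (\<lambda>s. Q s * R (1 - s))"
    by (rule integrable_mult_square[OF D(1) R_meas D(2) R_refl_sq])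
  have QB: "integrable unit_lborel (\<lambda>s. (Q s - \<beta>)\<^sup>2)"
    using integrable_square_add[OF D(1) _ D(2), of "\<lambda>_. - \<beta>"] by simp
  have "(LINT s:{0..<1}|lborel. (Q s - \<beta>)\<^sup>2) + lam * (LINT s:{0..<1}|lborel. Q s * R (1 - s)) =
    (LINT s|unit_lborel. (Q s - \<beta>)\<^sup>2) + lam * (LINT s|unit_lborel. Q s * R (1 - s))"
    by (simp only: integral_unit_eq[OF s])
  also have "\<dots> = (LINT s|unit_lborel. (Q s - \<beta>)\<^sup>2 + lam * (Q s * R (1 - s)))"
    using QR QB by simp
  also have "\<dots> = (LINT s|unit_lborel. (Q s)\<^sup>2 - 2 * a s * Q s + \<beta>\<^sup>2)"
    by (rule Bochner_Integration.integral_cong) (auto simp: a_def power2_eq_square algebra_simps)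
  finally show ?thesis .
qed

lemma quadratic_integrable:
  assumes Q: "Q \<in> Qset"
  shows "integrable unit_lborel (\<lambda>s. (Q s)\<^sup>2 - 2 * a s * Q s + \<beta>\<^sup>2)"
  using QsetD(2)[OF Q] integrable_mult_square[OF a_meas QsetD(1)[OF Q] a_sq QsetD(2)[OF Q]]
  by (simp add: mult.assoc)

lemma Lagr_eq:
  assumes Q: "Q \<in> Qset"
  shows "Lagr R Q0 Q v \<beta> lam = ereal (LINT s|unit_lborel. (Q s)\<^sup>2 - 2 * a s * Q s + \<beta>\<^sup>2) - (int_dw Q v - int_dw Q0 v)"
  unfolding Lagr_def quadratic_part[OF Q] ..

lemma qp_integrable:
  assumes "integrable unit_lborel p"
  shows "integrable unit_lborel (\<lambda>s. q s * p s)"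
proof (rule Bochner_Integration.integrable_bound)
  show "integrable unit_lborel (\<lambda>s. C * p s)" using assms by simp
  show "AE s in unit_lborel. norm (q s * p s) \<le> norm (C * p s)"
    using q_bound C0 by (auto simp: abs_mult intro!: AE_I2 mult_right_mono)
qed (use assms in simp)

lemma int_dw_Q0:
  assumes "Wicx_density v p"
  shows "int_dw Q0 v = ereal (LINT s|unit_lborel. q s * p s)"
proof -
  interpret Wicx_density v p by fact
  have m: "Q0 \<in> borel_measurable unit_lborel"
    by (rule measurable_unit_mono) (use Q0_mono in \<open>auto simp: mono_on_def\<close>)
  have c: "integrable unit_lborel (\<lambda>s. Q0 s * p s) \<longleftrightarrow> integrable unit_lborel (\<lambda>s. q s * p s)"
    by (rule Bochner_Integration.integrable_cong) (auto simp: q_def)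
  have "(LINT s|unit_lborel. Q0 s * p s) = (LINT s|unit_lborel. q s * p s)"
    by (rule Bochner_Integration.integral_cong) (auto simp: q_def)
  then show ?thesis using int_dw_eq[OF m] c qp_integrable[OF p_integrable] by simp
qed

lemma Lagr_density:
  assumes d: "Wicx_density v p" and Q: "Q \<in> Qset" and Qp: "integrable unit_lborel (\<lambda>s. Q s * p s)"
  shows "Lagr R Q0 Q v \<beta> lam = ereal (LINT s|unit_lborel. (Q s)\<^sup>2 - 2 * a s * Q s + \<beta>\<^sup>2 - Q s * p s + q s * p s)"
proof -
  interpret Wicx_density v p by fact
  show ?thesis
    unfolding Lagr_eq[OF Q] int_dw_Q0[OF d] int_dw_eq[OF QsetD(1)[OF Q] Qp]
    using quadratic_integrable[OF Q] Qp qp_integrable[OF p_integrable] by simp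
qed

lemma J_integrable:
  assumes [measurable]: "p \<in> borel_measurable unit_lborel" and p: "integrable unit_lborel (\<lambda>s. (p s)\<^sup>2)"
  shows "integrable unit_lborel (\<lambda>s. (a s + p s / 2)\<^sup>2)" "integrable unit_lborel (\<lambda>s. \<beta>\<^sup>2 - (a s + p s / 2)\<^sup>2 + q s * p s)"
proof -
  show 1: "integrable unit_lborel (\<lambda>s. (a s + p s / 2)\<^sup>2)"
    by (rule integrable_square_add[OF a_meas _ a_sq]) (use p in \<open>simp_all add: power_divide\<close>)
  show "integrable unit_lborel (\<lambda>s. \<beta>\<^sup>2 - (a s + p s / 2)\<^sup>2 + q s * p s)"
    using 1 qp_integrable[OF unit.square_integrable_imp_integrable[OF _ p]] by simp
qed

text \<open>The integrand of the Lagrangian exceeds that of \<open>J \<phi>\<close> by the square of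
  \<open>Q s - (a s + \<phi> s / 2)\<close>.\<close>

lemma dual_obj_W_ge: "ereal (J \<phi>) \<le> dual_obj R Q0 W \<beta> lam"
  unfolding dual_obj_def
proof (rule INF_greatest)
  fix Q assume Q: "Q \<in> Qset"
  have Qp: "integrable unit_lborel (\<lambda>s. Q s * \<phi> s)"
    by (rule integrable_mult_square[OF QsetD(1)[OF Q] phi_meas QsetD(2)[OF Q] phi_sq])
  have "J \<phi> \<le> (LINT s|unit_lborel. (Q s)\<^sup>2 - 2 * a s * Q s + \<beta>\<^sup>2 - Q s * \<phi> s + q s * \<phi> s)"
    unfolding J_def
  proof (rule integral_mono)
    show "integrable unit_lborel (\<lambda>s. (Q s)\<^sup>2 - 2 * a s * Q s + \<beta>\<^sup>2 - Q s * \<phi> s + q s * \<phi> s)"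
      using quadratic_integrable[OF Q] Qp qp_integrable[OF phi_integrable] by simp
    fix s
    have "0 \<le> (Q s - (a s + \<phi> s / 2))\<^sup>2" by simp
    then show "\<beta>\<^sup>2 - (a s + \<phi> s / 2)\<^sup>2 + q s * \<phi> s \<le> (Q s)\<^sup>2 - 2 * a s * Q s + \<beta>\<^sup>2 - Q s * \<phi> s + q s * \<phi> s"
      by (simp add: power2_eq_square algebra_simps)
  qed (rule J_integrable(2)[OF phi_meas phi_sq])
  then show "ereal (J \<phi>) \<le> Lagr R Q0 Q W \<beta> lam"
    unfolding Lagr_density[OF W_density Q Qp] by simp
qed

text \<open>Truncating the minimiser \<open>g\<close> at \<open>- real n\<close> gives it a right
  continuous version in \<open>Qset\<close>, finite at 0. Its Lagrangian exceeds \<open>J p\<close>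
  by the integral of \<open>e n\<close>, which tends to 0 by dominated convergence with bound
  \<open>(g s)\<^sup>2\<close>.\<close>

lemma dual_obj_le_J:
  assumes d: "Wicx_density v p" and p_sq: "integrable unit_lborel (\<lambda>s. (p s)\<^sup>2)"
  shows "dual_obj R Q0 v \<beta> lam \<le> ereal (J p)"
proof -
  interpret Wicx_density v p by fact
  define g where "g s = a s + p s / 2" for s
  have g_meas[measurable]: "g \<in> borel_measurable unit_lborel" unfolding g_def by measurable
  have g_sq: "integrable unit_lborel (\<lambda>s. (g s)\<^sup>2)" unfolding g_def by (rule J_integrable(1)[OF p_meas p_sq])
  have g_mono: "mono_on {0<..<1} g"
    using a_mono p_mono unfolding g_def mono_on_def by (auto intro!: add_mono divide_right_mono)
  define e where "e n s = (max (- real n) (g s) - g s)\<^sup>2" for n s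
  have e_le: "e n s \<le> (g s)\<^sup>2" for n s
    unfolding e_def by (auto simp: max_def abs_le_square_iff[symmetric])
  have e_int: "integrable unit_lborel (e n)" for n
  proof (rule Bochner_Integration.integrable_bound[OF g_sq])
    show "e n \<in> borel_measurable unit_lborel" unfolding e_def by measurable
    show "AE s in unit_lborel. norm (e n s) \<le> norm ((g s)\<^sup>2)"
      using e_le[of n] by (auto simp: e_def)
  qed
  have e_lim: "(\<lambda>n. LINT s|unit_lborel. e n s) \<longlonglongrightarrow> (LINT s|unit_lborel. 0)"
  proof (rule integral_dominated_convergence[OF _ _ g_sq])
    show "AE s in unit_lborel. (\<lambda>n. e n s) \<longlonglongrightarrow> 0"
    proof (rule AE_I2, rule tendsto_eventually)
      fix s
      obtain n0 where "- g s < real n0" using reals_Archimedean2 by blast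
      then show "eventually (\<lambda>n. e n s = 0) sequentially"
        unfolding eventually_sequentially by (intro exI[of _ n0]) (auto simp: e_def)
    qed
    show "AE s in unit_lborel. norm (e n s) \<le> (g s)\<^sup>2" for n
      using e_le[of n] by (auto simp: e_def)
  qed (auto simp: e_def)
  have le: "dual_obj R Q0 v \<beta> lam \<le> ereal (J p + (LINT s|unit_lborel. e n s))" for n
  proof -
    have "mono_on {0<..<1} (\<lambda>s. max (- real n) (g s))"
      by (rule mono_onI) (rule max.mono[OF order_refl mono_onD[OF g_mono]])
    then obtain Q where Q: "mono_on {0..<1} Q" "\<And>s. 0 \<le> s \<Longrightarrow> s < 1 \<Longrightarrow> continuous (at_right s) Q"
      and ae: "AE s in unit_lborel. Q s = max (- real n) (g s)"
      by (rule right_continuous_version[of _ "- real n"]) auto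
    have Qm[measurable]: "Q \<in> borel_measurable unit_lborel"
      by (rule measurable_unit_mono) (use Q(1) in \<open>auto simp: mono_on_def\<close>)
    have "integrable unit_lborel (\<lambda>s. ((max (- real n) (g s) - g s) + g s)\<^sup>2)"
      by (rule integrable_square_add) (use e_int[of n] g_sq in \<open>simp_all add: e_def[abs_def]\<close>)
    then have "integrable unit_lborel (\<lambda>s. (max (- real n) (g s))\<^sup>2)" by simp
    also have "?this \<longleftrightarrow> integrable unit_lborel (\<lambda>s. (Q s)\<^sup>2)"
      by (rule integrable_cong_AE) (use ae in auto)
    finally have Qs: "Q \<in> Qset" using QsetI[OF Q] by simp
    have Qp: "integrable unit_lborel (\<lambda>s. Q s * p s)"
      by (rule integrable_mult_square[OF QsetD(1)[OF Qs] p_meas QsetD(2)[OF Qs] p_sq])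
    have "Lagr R Q0 Q v \<beta> lam = ereal (LINT s|unit_lborel. (Q s)\<^sup>2 - 2 * a s * Q s + \<beta>\<^sup>2 - Q s * p s + q s * p s)"
      by (rule Lagr_density[OF d Qs Qp])
    also have "(LINT s|unit_lborel. (Q s)\<^sup>2 - 2 * a s * Q s + \<beta>\<^sup>2 - Q s * p s + q s * p s) =
      (LINT s|unit_lborel. (\<beta>\<^sup>2 - (a s + p s / 2)\<^sup>2 + q s * p s) + e n s)"
    proof (rule integral_cong_AE)
      show "AE s in unit_lborel. (Q s)\<^sup>2 - 2 * a s * Q s + \<beta>\<^sup>2 - Q s * p s + q s * p s =
        (\<beta>\<^sup>2 - (a s + p s / 2)\<^sup>2 + q s * p s) + e n s"
        using ae
      proof eventually_elim
        case (elim s)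
        show ?case unfolding elim e_def by (simp add: g_def power2_eq_square algebra_simps)
      qed
    qed (auto simp: e_def)
    also have "\<dots> = J p + (LINT s|unit_lborel. e n s)"
      unfolding J_def by (rule Bochner_Integration.integral_add[OF J_integrable(2)[OF p_meas p_sq] e_int])
    finally show ?thesis unfolding dual_obj_def using INF_lower[OF Qs] by metis
  qed
  have "(\<lambda>n. ereal (J p + (LINT s|unit_lborel. e n s))) \<longlonglongrightarrow> ereal (J p + (LINT s|unit_lborel. 0))"
    by (intro tendsto_intros e_lim)
  then show ?thesis
    by (intro LIMSEQ_le_const[where X = "\<lambda>n. ereal (J p + (LINT s|unit_lborel. e n s))"]) (use le in auto)
qed

section \<open>The variational inequality and its consequence\<close>

text \<open>The term with \<open>\<phi>\<close> vanishes by orthogonality, and the term with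
  \<open>p\<close> is nonnegative by \<open>phi_dual_cone\<close>. That lemma wants a monotone
  function on the closed interval, while \<open>p\<close> may be unbounded near 1. So
  \<open>p\<close> is cut off at \<open>n\<close>, given the value \<open>n\<close> at 1, and
  recovered as \<open>n\<close> grows.\<close>

lemma projection:
  assumes p_mono: "mono_on {0..<1} p" and p_nonneg: "\<And>x. 0 \<le> x \<Longrightarrow> x < 1 \<Longrightarrow> 0 \<le> p x"
    and p_sq: "integrable unit_lborel (\<lambda>s. (p s)\<^sup>2)"
  shows "0 \<le> (LINT s|unit_lborel. (p s - \<phi> s) * (\<phi> s + h s))"
proof -
  have p_meas[measurable]: "p \<in> borel_measurable unit_lborel"
    by (rule measurable_unit_mono) (use p_mono in \<open>auto simp: mono_on_def\<close>)
  define f where "f s = \<phi> s + h s" for s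
  have f_meas[measurable]: "f \<in> borel_measurable unit_lborel"
    unfolding f_def using h_integrable by measurable
  have h_sq: "integrable unit_lborel (\<lambda>s. (h s)\<^sup>2)"
    unfolding h_def
    using integrable_square_add[of "\<lambda>s. 2 * a s" unit_lborel "\<lambda>s. - 2 * q s"] a_sq q_sq by (simp add: power_mult_distrib)
  have f_sq: "integrable unit_lborel (\<lambda>s. (f s)\<^sup>2)"
    unfolding f_def by (rule integrable_square_add) (use phi_sq h_sq h_integrable in auto)
  have pf: "integrable unit_lborel (\<lambda>s. p s * f s)"
    by (rule integrable_mult_square[OF p_meas f_meas p_sq f_sq])
  have phif: "integrable unit_lborel (\<lambda>s. \<phi> s * f s)"
    by (rule integrable_mult_square[OF phi_meas f_meas phi_sq f_sq])
  have 0: "(LINT s|unit_lborel. \<phi> s * f s) = 0"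
    unfolding unit_integral_eq_HK[OF phif] using phi_orthogonal by (simp add: f_def integral_unique)
  have pn: "0 \<le> (LINT s|unit_lborel. min (p s) (real n) * f s)" for n
  proof -
    define pn where "pn s = (if s < 1 then min (p s) (real n) else real n)" for s
    have int: "integrable unit_lborel (\<lambda>s. min (p s) (real n) * f s)"
    proof (rule Bochner_Integration.integrable_bound[OF pf])
      show "AE s in unit_lborel. norm (min (p s) (real n) * f s) \<le> norm (p s * f s)"
        using p_nonneg by (auto simp: abs_mult intro!: AE_I2 mult_right_mono)
    qed simp
    have "mono_on {0..1} pn"
      unfolding pn_def by (rule mono_onI) (use mono_onD[OF p_mono] in \<open>force simp: min_le_iff_disj\<close>)
    moreover have "0 \<le> pn 0" using p_nonneg[of 0] by (simp add: pn_def)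
    ultimately have "0 \<le> integral {0..1} (\<lambda>s. pn s * f s)"
      unfolding f_def by (rule phi_dual_cone(2))
    also have "integral {0..1} (\<lambda>s. pn s * f s) = integral {0..1} (\<lambda>s. min (p s) (real n) * f s)"
      by (rule integral_spike[of "{1}"]) (auto simp: pn_def)
    finally show ?thesis unfolding unit_integral_eq_HK[OF int] .
  qed
  have "(\<lambda>n. LINT s|unit_lborel. min (p s) (real n) * f s) \<longlonglongrightarrow> (LINT s|unit_lborel. p s * f s)"
  proof (rule integral_dominated_convergence)
    show "integrable unit_lborel (\<lambda>s. \<bar>p s * f s\<bar>)" using pf by (rule integrable_abs)
    show "AE s in unit_lborel. (\<lambda>n. min (p s) (real n) * f s) \<longlonglongrightarrow> p s * f s"
    proof (rule AE_I2, rule tendsto_eventually)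
      fix s
      obtain n0 where "p s < real n0" using reals_Archimedean2 by blast
      then show "eventually (\<lambda>n. min (p s) (real n) * f s = p s * f s) sequentially"
        unfolding eventually_sequentially by (intro exI[of _ n0]) (auto simp: min_def)
    qed
    show "AE s in unit_lborel. norm (min (p s) (real n) * f s) \<le> \<bar>p s * f s\<bar>" for n
      using p_nonneg by (auto simp: abs_mult intro!: AE_I2 mult_right_mono)
  qed auto
  then have "0 \<le> (LINT s|unit_lborel. p s * f s)"
    by (rule LIMSEQ_le_const) (use pn in auto)
  then show ?thesis using 0 pf phif by (simp add: f_def[symmetric] left_diff_distrib)
qed

text \<open>\<open>J \<phi> - J p\<close> is a quarter of the squared distance of \<open>p\<close>
  and \<open>\<phi>\<close> plus half of the integral in \<open>projection\<close>. Both are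
  nonnegative, so the distance is 0 and the two Stieltjes measures coincide.\<close>

lemma eq_W_if_J_ge:
  assumes d: "Wicx_density v p" and p_sq: "integrable unit_lborel (\<lambda>s. (p s)\<^sup>2)"
    and ge: "J \<phi> \<le> J p" and s: "s \<in> {0..1}"
  shows "v s = W s"
proof -
  interpret v: Wicx_density v p by fact
  interpret W: Wicx_density W \<phi> by (rule W_density)
  have pm[measurable]: "p \<in> borel_measurable unit_lborel" by (rule v.p_meas)
  have hm[measurable]: "h \<in> borel_measurable unit_lborel" using h_integrable by measurable
  define f where "f s = (p s - \<phi> s) * (\<phi> s + h s)" for s
  have sq: "integrable unit_lborel (\<lambda>s. (p s - \<phi> s)\<^sup>2)"
    using integrable_square_add[of p unit_lborel "\<lambda>s. - \<phi> s"] p_sq phi_sq by simp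
  have split: "\<beta>\<^sup>2 - (a s + \<phi> s / 2)\<^sup>2 + q s * \<phi> s - (\<beta>\<^sup>2 - (a s + p s / 2)\<^sup>2 + q s * p s) =
    (p s - \<phi> s)\<^sup>2 / 4 + f s / 2" for s
    by (simp add: f_def h_def power2_eq_square field_simps)
  \<comment> \<open>This is \<open>split\<close> solved for \<open>f\<close>, whose integrability it
    yields.\<close>
  have "integrable unit_lborel (\<lambda>s. 2 * (\<beta>\<^sup>2 - (a s + \<phi> s / 2)\<^sup>2 + q s * \<phi> s - (\<beta>\<^sup>2 - (a s + p s / 2)\<^sup>2 + q s * p s))
      - (p s - \<phi> s)\<^sup>2 / 2)"
    by (intro Bochner_Integration.integrable_diff integrable_mult_right integrable_divide
      J_integrable(2)[OF phi_meas phi_sq] J_integrable(2)[OF pm p_sq] sq)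
  then have f_int: "integrable unit_lborel f" unfolding split by (simp add: field_simps)
  have "J \<phi> - J p = (LINT s|unit_lborel. (p s - \<phi> s)\<^sup>2 / 4 + f s / 2)"
    unfolding J_def
    by (subst Bochner_Integration.integral_diff[symmetric, OF J_integrable(2)[OF phi_meas phi_sq] J_integrable(2)[OF pm p_sq]])
      (simp only: split)
  also have "\<dots> = (LINT s|unit_lborel. (p s - \<phi> s)\<^sup>2) / 4 + (LINT s|unit_lborel. f s) / 2"
    using sq f_int by simp
  finally have "(LINT s|unit_lborel. (p s - \<phi> s)\<^sup>2) \<le> 0"
    using ge projection[OF v.p_mono v.p_nonneg p_sq] by (simp add: f_def)
  then have "(LINT s|unit_lborel. (p s - \<phi> s)\<^sup>2) = 0"
    by (intro antisym integral_nonneg_AE) auto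
  then have ae: "AE s in unit_lborel. p s = \<phi> s"
    using integral_nonneg_eq_0_iff_AE[OF sq] by auto
  then have "AE s in lborel. 0 < s \<and> s < 1 \<longrightarrow> p s = \<phi> s"
    by (subst (asm) AE_restrict_space_iff) auto
  then have "v.\<nu> = W.\<nu>"
    unfolding v.\<nu>_def W.\<nu>_def
    using v.dens_meas W.dens_meas
    by (intro density_cong) (simp, simp, auto elim!: eventually_mono simp: indicator_def)
  then have "emeasure (stieltjes v) {t<..} = emeasure (stieltjes W) {t<..}" for t
    using v.stieltjes_eq_density W.stieltjes_eq_density by simp
  then have e: "ennreal (v 1 - v (clamp01 t)) = ennreal (W 1 - W (clamp01 t))" for t
    using emeasure_stieltjes_Ioi[OF v.v, of t] emeasure_stieltjes_Ioi[OF W_Wicx, of t] by simp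
  have eq: "v 1 - v t = W 1 - W t" if "t \<in> {0..1}" for t
    using e[of t] that mono_onD[OF WicxD(1)[OF v.v], of t 1] mono_onD[OF W_mono, of t 1] by simp
  \<comment> \<open>The measures determine increments only; the normalisation at 0 fixes the
    constant.\<close>
  have "v 1 = W 1" using eq[of 0] WicxD(3)[OF v.v] W_0 by simp
  then show ?thesis using eq[OF s] by simp
qed

end

section \<open>Competitors with finite dual value\<close>

lemma Wicx_density_right_slope:
  assumes v: "v \<in> Wicx" and c: "continuous_on {0..1} v"
  shows "Wicx_density v (right_slope v)"
proof -
  interpret convex_lower_lipschitz v 0 by (rule Wicx_convex_lower_lipschitz[OF v])
  show ?thesis
    by standard (use v c right_slope_mono right_slope_ge right_slope_has_integral in auto)
qed

text \<open>Convexity gives continuity in the interior and, with monotonicity, a right derivative at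
  0. Only a jump at 1 is possible.\<close>

lemma Wicx_cont_if_left_cont_1:
  assumes v: "v \<in> Wicx" and lim: "(v \<longlongrightarrow> v 1) (at_left 1)"
  shows "continuous_on {0..1} v"
  unfolding continuous_on_eq_continuous_within
proof
  fix x :: real assume x: "x \<in> {0..1}"
  interpret convex_lower_lipschitz v 0 by (rule Wicx_convex_lower_lipschitz[OF v])
  have right: "(v \<longlongrightarrow> v x) (at_right x)" if "x < 1"
    using DERIV_continuous[OF right_slope_deriv[of x]] x that by (simp add: continuous_within)
  consider "x = 0" | "x = 1" | "0 < x" "x < 1" using x by fastforce
  then show "continuous (at x within {0..1}) v"
  proof cases
    case 1
    have "(v \<longlongrightarrow> v x) (at x within {0..1})"
      using right 1 by (auto simp: at_within_Icc_at_right)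
    then show ?thesis by (simp add: continuous_within)
  next
    case 2
    have "(v \<longlongrightarrow> v x) (at x within {0..1})"
      using lim 2 by (auto simp: at_within_Icc_at_left)
    then show ?thesis by (simp add: continuous_within)
  next
    case 3
    have "convex_on {0<..<1} v"
      by (rule convex_on_subset[OF conv]) auto
    then have "continuous_on {0<..<1} v" by (rule convex_on_continuous[rotated]) simp
    then have "isCont v x" using 3 by (simp add: continuous_on_eq_continuous_at)
    then show ?thesis by (rule continuous_at_imp_continuous_at_within)
  qed
qed

text \<open>The mass of \<open>{s<..1}\<close> includes a possible atom at 1, and there
  \<open>Qbar\<close> takes the left limit \<open>k\<close>.\<close>

lemma int_dw_step_ge:
  assumes v: "v \<in> Wicx" and s: "0 \<le> s" "s < 1" and k: "0 \<le> k"
  shows "ereal (k * (v 1 - v s)) \<le> int_dw (\<lambda>x. if s \<le> x then k else 0) v"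
proof -
  let ?Q = "\<lambda>x. if s \<le> x then k else 0"
  have Qb: "ereal (if s < x then k else 0) \<le> Qbar ?Q x" for x
  proof -
    have "ereal (?Q s) \<le> (SUP t\<in>{0..<1}. ereal (?Q t))" by (rule SUP_upper) (use s in auto)
    then show ?thesis using s k by (auto simp: Qbar_def)
  qed
  have Q0: "0 \<le> Qbar ?Q x" for x
    using order_trans[OF _ Qb, of 0 x] k by auto
  have vs: "v s \<le> v 1" using mono_onD[OF WicxD(1)[OF v], of s 1] s by auto
  have "ennreal (k * (v 1 - v s)) = ennreal k * emeasure (stieltjes v) {s<..1}"
    using emeasure_stieltjes_Ioc[OF v, of s 1] s k vs by (simp add: ennreal_mult)
  also have "\<dots> = (\<integral>\<^sup>+x. ennreal k * indicator {s<..1} x \<partial>stieltjes v)"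
    by (subst nn_integral_cmult_indicator) auto
  also have "\<dots> \<le> (\<integral>\<^sup>+x. e2ennreal (Qbar ?Q x) * indicator {0..1} x \<partial>stieltjes v)"
  proof (rule nn_integral_mono)
    fix x
    show "ennreal k * indicator {s<..1} x \<le> e2ennreal (Qbar ?Q x) * indicator {0..1} x"
      using e2ennreal_mono[OF Qb[of x]] s by (auto simp: indicator_def split: if_splits)
  qed
  finally have "enn2ereal (ennreal (k * (v 1 - v s))) \<le>
      enn2ereal (\<integral>\<^sup>+x. e2ennreal (Qbar ?Q x) * indicator {0..1} x \<partial>stieltjes v)"
    by (simp add: less_eq_ennreal.rep_eq)
  moreover have "enn2ereal (ennreal (k * (v 1 - v s))) = ereal (k * (v 1 - v s))"
    using k vs by (intro enn2ereal_ennreal) simp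
  moreover have "(\<integral>\<^sup>+x. e2ennreal (- Qbar ?Q x) * indicator {0..1} x \<partial>stieltjes v) = 0"
  proof -
    have "e2ennreal (- Qbar ?Q x) = 0" for x by (rule e2ennreal_neg) (use Q0[of x] in simp)
    then show ?thesis by simp
  qed
  ultimately show ?thesis by (simp add: int_dw_def zero_ennreal.rep_eq)
qed

text \<open>The Stieltjes measure is finite, so a bounded \<open>Q\<close> has finite positive and
  negative parts, even if there is an atom at 1 and no density is available yet. It keeps the term
  with \<open>Q0\<close> in the Lagrangian real.\<close>

lemma int_dw_bounded_finite:
  assumes v: "v \<in> Wicx" and Q: "\<And>s. 0 \<le> s \<Longrightarrow> s < 1 \<Longrightarrow> \<bar>Q s\<bar> \<le> C"
  shows "\<exists>r. int_dw Q v = ereal r"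
proof -
  have C0: "0 \<le> C" using Q[of 0] by simp
  have fin: "(\<integral>\<^sup>+x. g x * indicator {0..1} x \<partial>stieltjes v) < \<infinity>"
    if "\<And>x. 0 \<le> x \<Longrightarrow> x \<le> 1 \<Longrightarrow> g x \<le> ennreal C" for g
  proof -
    have "(\<integral>\<^sup>+x. g x * indicator {0..1} x \<partial>stieltjes v) \<le> (\<integral>\<^sup>+x. ennreal C * indicator {-1<..} x \<partial>stieltjes v)"
      by (rule nn_integral_mono) (use that in \<open>auto simp: indicator_def\<close>)
    also have "\<dots> = ennreal C * emeasure (stieltjes v) {-1<..}"
      by (subst nn_integral_cmult_indicator) auto
    also have "\<dots> < \<infinity>"
      unfolding emeasure_stieltjes_Ioi[OF v] by (simp add: ennreal_mult_less_top)
    finally show ?thesis .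
  qed
  have b: "Qbar Q x \<le> ereal C \<and> - Qbar Q x \<le> ereal C" if x: "0 \<le> x" "x \<le> 1" for x
  proof (cases "x < 1")
    case True then show ?thesis using Q[OF x(1) True] by (simp add: Qbar_def abs_le_iff)
  next
    case False
    have "(SUP t\<in>{0..<1}. ereal (Q t)) \<le> ereal C"
      by (rule SUP_least) (use Q in \<open>auto simp: abs_le_iff\<close>)
    moreover have "- ereal C \<le> ereal (Q 0)" using Q[of 0] by (simp add: abs_le_iff)
    then have "- ereal C \<le> (SUP t\<in>{0..<1}. ereal (Q t))"
      by (rule order_trans) (rule SUP_upper, simp)
    then have "- (SUP t\<in>{0..<1}. ereal (Q t)) \<le> ereal C" by (simp add: ereal_uminus_le_reorder)
    ultimately show ?thesis using False by (simp add: Qbar_def)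
  qed
  have "(\<integral>\<^sup>+x. e2ennreal (Qbar Q x) * indicator {0..1} x \<partial>stieltjes v) < \<infinity>"
    "(\<integral>\<^sup>+x. e2ennreal (- Qbar Q x) * indicator {0..1} x \<partial>stieltjes v) < \<infinity>"
    by (rule fin, use e2ennreal_mono b in force)+
  moreover have e: "enn2ereal x = ereal (enn2real x)" if "x < \<infinity>" for x
    using that by (cases x) (auto simp: enn2ereal_ennreal)
  ultimately show ?thesis unfolding int_dw_def by (simp add: e)
qed

context sdf_dual
begin

text \<open>A step at \<open>s\<close> of height \<open>1 / sqrt (1 - s)\<close> has norm at most 1,
  so the quadratic part of the Lagrangian stays bounded, while the Stieltjes part subtracts at least
  the height times \<open>v 1 - v s\<close>. Hence this increment is of order
  \<open>sqrt (1 - s)\<close>.\<close>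

lemma left_cont_1_if_dual_ge:
  assumes v: "v \<in> Wicx" and ge: "ereal V \<le> dual_obj R Q0 v \<beta> lam"
  shows "(v \<longlongrightarrow> v 1) (at_left 1)"
proof -
  from int_dw_bounded_finite[OF v Q0_bound] obtain r where r: "int_dw Q0 v = ereal r" ..
  define A where "A = (LINT s|unit_lborel. (a s)\<^sup>2)"
  \<comment> \<open>\<open>2 + A\<close> bounds the quadratic part up to
    \<open>\<beta>\<^sup>2\<close>:
    \<open>- 2 * a x * Q x \<le> (Q x)\<^sup>2 + (a x)\<^sup>2\<close>, and the integral of
    \<open>(Q x)\<^sup>2\<close> is at most 1.\<close>
  define c where "c = 2 + A + \<beta>\<^sup>2 + r - V"
  have bound: "v 1 - v s \<le> c * sqrt (1 - s)" if s: "0 \<le> s" "s < 1" for s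
  proof -
    define k where "k = 1 / sqrt (1 - s)"
    have k: "0 < k" "k\<^sup>2 * (1 - s) = 1" using s by (auto simp: k_def power_divide)
    define Q where "Q = (\<lambda>x. if s \<le> x then k else 0)"
    have Qsq: "(\<lambda>x. (Q x)\<^sup>2) = (\<lambda>x. k\<^sup>2 * indicator {s..} x)" by (auto simp: Q_def indicator_def)
    have Qint: "integrable unit_lborel (\<lambda>x. (Q x)\<^sup>2)"
      unfolding Qsq by (intro integrable_mult_right unit.integrable_const_bound[of _ 1]) (auto intro: measurable_restrict_space1)
    have Qs: "Q \<in> Qset"
    proof (rule QsetI[OF _ _ Qint])
      show "mono_on {0..<1} Q" by (rule mono_onI) (use k in \<open>auto simp: Q_def\<close>)
      fix x :: real assume x: "0 \<le> x" "x < 1"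
      define y where "y = (if x < s then s else 1)"
      have "eventually (\<lambda>t. t \<in> {x<..<y}) (at_right x)" by (rule eventually_at_right_real) (use x in \<open>auto simp: y_def\<close>)
      then have "eventually (\<lambda>t. Q t = Q x) (at_right x)"
        by eventually_elim (auto simp: Q_def y_def split: if_splits)
      then show "continuous (at_right x) Q" unfolding continuous_within by (rule tendsto_eventually)
    qed
    have "(LINT x|unit_lborel. (Q x)\<^sup>2) = k\<^sup>2 * measure unit_lborel ({s..} \<inter> {0<..<1})"
      unfolding Qsq by (simp add: Int_commute)
    also have "measure unit_lborel ({s..} \<inter> {0<..<1}) \<le> 1 - s"
    proof -
      have "measure unit_lborel ({s..} \<inter> {0<..<1}) = measure lborel ({s..} \<inter> {0<..<1})"
        by (rule measure_restrict_space) auto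
      also have "\<dots> \<le> measure lborel {s..1}" by (rule measure_mono_fmeasurable) (auto intro: fmeasurable_compact)
      finally show ?thesis using s by simp
    qed
    finally have Q1: "(LINT x|unit_lborel. (Q x)\<^sup>2) \<le> 1" using k by (simp add: mult_left_mono)
    have "(LINT x|unit_lborel. (Q x)\<^sup>2 - 2 * a x * Q x + \<beta>\<^sup>2) \<le> (LINT x|unit_lborel. 2 * (Q x)\<^sup>2 + (a x)\<^sup>2 + \<beta>\<^sup>2)"
    proof (rule integral_mono[OF quadratic_integrable[OF Qs]])
      show "integrable unit_lborel (\<lambda>x. 2 * (Q x)\<^sup>2 + (a x)\<^sup>2 + \<beta>\<^sup>2)" using Qint a_sq by simp
      fix x
      have "0 \<le> (Q x + a x)\<^sup>2" by simp
      then show "(Q x)\<^sup>2 - 2 * a x * Q x + \<beta>\<^sup>2 \<le> 2 * (Q x)\<^sup>2 + (a x)\<^sup>2 + \<beta>\<^sup>2"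
        by (simp add: power2_eq_square algebra_simps)
    qed
    also have "\<dots> = 2 * (LINT x|unit_lborel. (Q x)\<^sup>2) + A + \<beta>\<^sup>2"
      using Qint a_sq unit.prob_space by (simp add: A_def)
    also have "\<dots> \<le> 2 + A + \<beta>\<^sup>2" using Q1 by simp
    finally have quad: "(LINT x|unit_lborel. (Q x)\<^sup>2 - 2 * a x * Q x + \<beta>\<^sup>2) \<le> 2 + A + \<beta>\<^sup>2" .
    have "ereal V \<le> Lagr R Q0 Q v \<beta> lam"
      using ge INF_lower[OF Qs, of "\<lambda>Q. Lagr R Q0 Q v \<beta> lam"] unfolding dual_obj_def by (rule order_trans)
    also have "\<dots> \<le> ereal (2 + A + \<beta>\<^sup>2) - (ereal (k * (v 1 - v s)) - ereal r)"
      unfolding Lagr_eq[OF Qs] r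
      by (intro ereal_minus_mono) (use quad int_dw_step_ge[OF v s, of k] k in \<open>auto simp: Q_def\<close>)
    finally have "k * (v 1 - v s) \<le> c" by (simp add: c_def)
    then show ?thesis using s by (simp add: k_def field_simps)
  qed
  show ?thesis
  proof (rule tendsto_sandwich)
    have ev: "eventually (\<lambda>s. s \<in> {0<..<1}) (at_left (1::real))" by (rule eventually_at_left_real) simp
    show "eventually (\<lambda>s. v 1 - c * sqrt (1 - s) \<le> v s) (at_left 1)"
      using ev
    proof eventually_elim
      case (elim s)
      then show ?case using bound[of s] by simp
    qed
    show "eventually (\<lambda>s. v s \<le> v 1) (at_left 1)"
      using ev by eventually_elim (use mono_onD[OF WicxD(1)[OF v]] in auto)
    show "((\<lambda>s. v 1 - c * sqrt (1 - s)) \<longlongrightarrow> v 1) (at_left 1)"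
      by (auto intro!: tendsto_eq_intros)
  qed simp
qed

text \<open>Half of the truncated derivative is an admissible \<open>Q\<close> whose gain against
  \<open>p\<close> outweighs its quadratic cost. A lower bound on the dual value thus bounds the
  norms of the truncations uniformly, and monotone convergence applies.\<close>

lemma right_slope_square_integrable_if_dual_ge:
  assumes v: "v \<in> Wicx" and vc: "continuous_on {0..1} v" and ge: "ereal V \<le> dual_obj R Q0 v \<beta> lam"
  shows "integrable unit_lborel (\<lambda>s. (right_slope v s)\<^sup>2)"
proof -
  define p where "p = right_slope v"
  have d: "Wicx_density v p" unfolding p_def by (rule Wicx_density_right_slope[OF v vc])
  interpret convex_lower_lipschitz v 0 by (rule Wicx_convex_lower_lipschitz[OF v])
  interpret d: Wicx_density v p by (rule d)
  define A where "A = (LINT s|unit_lborel. (a s)\<^sup>2)"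
  define r where "r = (LINT s|unit_lborel. q s * p s)"
  define pn where "pn n s = min (p s) (real n)" for n s
  have pm[measurable]: "p \<in> borel_measurable unit_lborel" by (rule d.p_meas)
  have pn_meas[measurable]: "pn n \<in> borel_measurable unit_lborel" for n unfolding pn_def by measurable
  have p0: "0 \<le> p s" if "0 < s" "s < 1" for s using d.p_nonneg that by auto
  have pn_sq_int: "integrable unit_lborel (\<lambda>s. (pn n s)\<^sup>2)" for n
  proof (rule unit.integrable_const_bound[of _ "(real n)\<^sup>2"])
    show "AE s in unit_lborel. norm ((pn n s)\<^sup>2) \<le> (real n)\<^sup>2"
      using p0 by (auto intro!: AE_I2 power_mono simp: pn_def)
  qed simp
  \<comment> \<open>The 8 is \<open>2 * 4\<close>: half of \<open>(Q s)\<^sup>2\<close> survives in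
    the estimate, and \<open>(Q s)\<^sup>2\<close> is a quarter of
    \<open>(pn n s)\<^sup>2\<close>.\<close>
  have bound: "(LINT s|unit_lborel. (pn n s)\<^sup>2) \<le> 8 * (2 * A + \<beta>\<^sup>2 + r - V)" for n
  proof -
    define Q where "Q s = pn n s / 2" for s
    have Qint: "integrable unit_lborel (\<lambda>s. (Q s)\<^sup>2)" using pn_sq_int[of n] by (simp add: Q_def power_divide)
    have Qs: "Q \<in> Qset"
    proof (rule QsetI[OF _ _ Qint])
      show "mono_on {0..<1} Q"
      proof (rule mono_onI)
        fix x y :: real assume xy: "x \<in> {0..<1}" "y \<in> {0..<1}" "x \<le> y"
        show "Q x \<le> Q y" using mono_onD[OF d.p_mono xy] by (auto simp: Q_def pn_def)
      qed
      fix s :: real assume "0 \<le> s" "s < 1"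
      then have "(p \<longlongrightarrow> p s) (at_right s)"
        using right_slope_right_continuous by (simp add: p_def continuous_within)
      then show "continuous (at_right s) Q"
        unfolding continuous_within Q_def pn_def by (intro tendsto_intros) auto
    qed
    have Qp: "integrable unit_lborel (\<lambda>s. Q s * p s)"
    proof (rule Bochner_Integration.integrable_bound)
      show "integrable unit_lborel (\<lambda>s. real n * p s)" using d.p_integrable by simp
      show "AE s in unit_lborel. norm (Q s * p s) \<le> norm (real n * p s)"
      proof (rule AE_I2)
        fix s assume "s \<in> space unit_lborel"
        then have "0 \<le> p s" using p0 by simp
        then show "norm (Q s * p s) \<le> norm (real n * p s)"
          unfolding norm_mult by (intro mult_right_mono) (auto simp: Q_def pn_def)
      qed
    qed (simp add: Q_def)
    have "ereal V \<le> Lagr R Q0 Q v \<beta> lam"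
      using ge INF_lower[OF Qs, of "\<lambda>Q. Lagr R Q0 Q v \<beta> lam"] unfolding dual_obj_def by (rule order_trans)
    then have "V \<le> (LINT s|unit_lborel. (Q s)\<^sup>2 - 2 * a s * Q s + \<beta>\<^sup>2 - Q s * p s + q s * p s)"
      unfolding Lagr_density[OF d Qs Qp] by simp
    also have "\<dots> \<le> (LINT s|unit_lborel. 2 * (a s)\<^sup>2 + \<beta>\<^sup>2 + q s * p s - (Q s)\<^sup>2 / 2)"
    proof (rule integral_mono)
      show "integrable unit_lborel (\<lambda>s. (Q s)\<^sup>2 - 2 * a s * Q s + \<beta>\<^sup>2 - Q s * p s + q s * p s)"
        using quadratic_integrable[OF Qs] Qp qp_integrable[OF d.p_integrable] by simp
      show "integrable unit_lborel (\<lambda>s. 2 * (a s)\<^sup>2 + \<beta>\<^sup>2 + q s * p s - (Q s)\<^sup>2 / 2)"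
        using a_sq Qint qp_integrable[OF d.p_integrable] by simp
      fix s assume "s \<in> space unit_lborel"
      then have s: "0 < s" "s < 1" by auto
      \<comment> \<open>The gain \<open>Q s * p s\<close> exceeds the cost
        \<open>(Q s)\<^sup>2\<close> by at least \<open>(Q s)\<^sup>2\<close>. Half of this surplus
        absorbs the cross term with \<open>a s\<close>, at the price of
        \<open>2 * (a s)\<^sup>2\<close>.\<close>
      have "2 * Q s * Q s \<le> Q s * p s"
        using p0[OF s] mult_left_mono[of "2 * Q s" "p s" "Q s"] by (simp add: Q_def pn_def)
      moreover have "0 \<le> (Q s + 2 * a s)\<^sup>2" by simp
      ultimately show "(Q s)\<^sup>2 - 2 * a s * Q s + \<beta>\<^sup>2 - Q s * p s + q s * p s \<le> 2 * (a s)\<^sup>2 + \<beta>\<^sup>2 + q s * p s - (Q s)\<^sup>2 / 2"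
        by (simp add: power2_eq_square algebra_simps)
    qed
    also have "\<dots> = 2 * A + \<beta>\<^sup>2 + r - (LINT s|unit_lborel. (Q s)\<^sup>2) / 2"
      using a_sq Qint qp_integrable[OF d.p_integrable] unit.prob_space by (simp add: A_def r_def)
    also have "(LINT s|unit_lborel. (Q s)\<^sup>2) = (LINT s|unit_lborel. (pn n s)\<^sup>2) / 4"
      by (simp add: Q_def power_divide)
    finally show ?thesis by simp
  qed
  have pn_mono: "(pn m s)\<^sup>2 \<le> (pn n s)\<^sup>2" if "m \<le> n" "s \<in> {0<..<1}" for m n s
    using that p0[of s] by (intro power_mono) (auto simp: pn_def)
  have inc: "incseq (\<lambda>n. LINT s|unit_lborel. (pn n s)\<^sup>2)"
    by (rule incseq_SucI, rule integral_mono[OF pn_sq_int pn_sq_int]) (use pn_mono in auto)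
  then obtain l where l: "(\<lambda>n. LINT s|unit_lborel. (pn n s)\<^sup>2) \<longlonglongrightarrow> l"
    using incseq_convergent[OF inc, of "8 * (2 * A + \<beta>\<^sup>2 + r - V)"] bound by blast
  have "integrable unit_lborel (\<lambda>s. (p s)\<^sup>2)"
  proof (rule integrable_monotone_convergence[OF pn_sq_int _ _ l])
    show "AE s in unit_lborel. mono (\<lambda>n. (pn n s)\<^sup>2)"
      by (rule AE_I2) (auto intro!: monoI pn_mono)
    show "AE s in unit_lborel. (\<lambda>n. (pn n s)\<^sup>2) \<longlonglongrightarrow> (p s)\<^sup>2"
    proof (rule AE_I2, rule tendsto_eventually)
      fix s
      obtain n0 where "p s < real n0" using reals_Archimedean2 by blast
      then show "eventually (\<lambda>n. (pn n s)\<^sup>2 = (p s)\<^sup>2) sequentially"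
        unfolding eventually_sequentially by (intro exI[of _ n0]) (auto simp: pn_def min_def)
    qed
  qed simp
  then show ?thesis by (simp add: p_def)
qed

section \<open>Existence and uniqueness of the maximiser\<close>

text \<open>Maximality and uniqueness of \<open>W\<close> both rest on this comparison. A competitor
  below \<open>J \<phi>\<close> is below \<open>W\<close> by \<open>dual_obj_W_ge\<close>, and a
  maximiser has to reach \<open>J \<phi>\<close> because \<open>W\<close> does.\<close>

lemma eq_W_if_dual_ge:
  assumes v: "v \<in> Wicx" and ge: "ereal (J \<phi>) \<le> dual_obj R Q0 v \<beta> lam" and s: "s \<in> {0..1}"
  shows "v s = W s"
proof -
  have vc: "continuous_on {0..1} v"
    by (rule Wicx_cont_if_left_cont_1[OF v left_cont_1_if_dual_ge[OF v ge]])
  note d = Wicx_density_right_slope[OF v vc]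
  note p_sq = right_slope_square_integrable_if_dual_ge[OF v vc ge]
  have "ereal (J \<phi>) \<le> ereal (J (right_slope v))"
    using ge dual_obj_le_J[OF d p_sq] by (rule order_trans)
  then show ?thesis using eq_W_if_J_ge[OF d p_sq _ s] by simp
qed

text \<open>\<open>stieltjes\<close> clamps its argument, so the values outside
  \<open>{0..1}\<close>, on which \<open>Wicx\<close> is silent, do not enter.\<close>

lemma dual_obj_cong:
  assumes "\<And>s. s \<in> {0..1} \<Longrightarrow> v s = w s"
  shows "dual_obj R Q0 v \<beta> lam = dual_obj R Q0 w \<beta> lam"
proof -
  have "(\<lambda>x. v (clamp01 x)) = (\<lambda>x. w (clamp01 x))" using assms by auto
  then have "stieltjes v = stieltjes w" by (simp add: stieltjes_def)
  then show ?thesis by (simp add: dual_obj_def Lagr_def int_dw_def)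
qed

lemma dual_obj_le_W:
  assumes v: "v \<in> Wicx"
  shows "dual_obj R Q0 v \<beta> lam \<le> dual_obj R Q0 W \<beta> lam"
proof (cases "ereal (J \<phi>) \<le> dual_obj R Q0 v \<beta> lam")
  case True
  then have "dual_obj R Q0 v \<beta> lam = dual_obj R Q0 W \<beta> lam"
    by (intro dual_obj_cong eq_W_if_dual_ge[OF v])
  then show ?thesis by simp
next
  case False
  then show ?thesis using dual_obj_W_ge by (meson le_cases order_trans)
qed

lemma W_unique:
  assumes v: "v \<in> Wicx" and max: "\<And>u. u \<in> Wicx \<Longrightarrow> dual_obj R Q0 u \<beta> lam \<le> dual_obj R Q0 v \<beta> lam"
    and s: "s \<in> {0..1}"
  shows "v s = W s"
  by (rule eq_W_if_dual_ge[OF v _ s]) (use dual_obj_W_ge max[OF W_Wicx] in \<open>rule order_trans\<close>)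

section \<open>The envelope of \<open>Hfun\<close> and the derivative of \<open>W\<close>\<close>

lemma Hfun_eq:
  assumes "s \<in> {0..1}"
  shows "Hfun R Q0 \<beta> lam s = H s"
proof -
  have "set_integrable lborel {0..1} h" by (rule integrable_unit_iff[THEN iffD1, OF _ _ h_integrable]) auto
  then have int: "set_integrable lborel {0..s} h" by (rule set_integrable_subset) (use assms in auto)
  have "Hfun R Q0 \<beta> lam s = (LINT t:{0..s}|lborel. h t)"
    unfolding Hfun_def set_lebesgue_integral_def
    by (rule integral_discrete_difference[where X = "{0, 1}"])
      (use assms in \<open>auto simp: indicator_def h_def a_def q_def\<close>)
  then show ?thesis using set_borel_integral_eq_integral(2)[OF int] by (simp add: H_def)
qed

lemma concave_envelope_Hfun: "concave_envelope (Hfun R Q0 \<beta> lam) = concave_envelope H"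
proof -
  have "(\<forall>t\<in>{0..1}. Hfun R Q0 \<beta> lam t \<le> g t) = (\<forall>t\<in>{0..1}. H t \<le> g t)" for g
    by (rule ball_cong[OF refl]) (simp only: Hfun_eq)
  then show ?thesis unfolding concave_envelope_def by simp
qed

lemma rderiv_W: "s \<in> {0..<1} \<Longrightarrow> rderiv W s = \<phi> s"
  using rderiv_eqI[OF W_right_deriv[of s]] by (simp add: \<phi>_def P1_def)

lemma W_Wc2: "W \<in> Wc2"
proof -
  have "set_integrable lborel {0..<1} (\<lambda>s. (\<phi> s)\<^sup>2)"
    by (rule integrable_unit_iff[THEN iffD1, OF _ _ phi_sq]) auto
  also have "?this \<longleftrightarrow> set_integrable lborel {0..<1} (\<lambda>s. (rderiv W s)\<^sup>2)"
    unfolding set_integrable_def by (rule Bochner_Integration.integrable_cong) (auto simp: indicator_def rderiv_W)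
  finally show ?thesis using W_Wicx W_cont by (simp add: Wc2_def)
qed

lemma envelope_W_right_deriv:
  assumes "s \<in> {0..<1}"
  shows "\<exists>d. (concave_envelope (Hfun R Q0 \<beta> lam) has_real_derivative d) (at_right s)
    \<and> (W has_real_derivative max 0 (- d)) (at_right s)"
  unfolding concave_envelope_Hfun
  using E_right_deriv[of s] W_right_deriv[of s] assms by (intro exI[of _ "- P s"]) auto

lemma rderiv_W_bounded: "\<exists>b. \<forall>s\<in>{0..<1}. \<bar>rderiv W s\<bar> \<le> b"
  using phi_nonneg phi_le by (intro exI[of _ "K + 2 * M"]) (auto simp: rderiv_W)

end

section \<open>Quantile functions\<close>

context cdf_distribution
begin

text \<open>The counterpart of the lower quantile function \<open>I\<close>, which is known to push
  Lebesgue measure on the unit interval forward to \<open>M\<close>.\<close>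

definition upper_I :: "real \<Rightarrow> real" where
  "upper_I s = Inf {x. s < C x}"

lemma upper_I_nonempty:
  assumes "s < 1" shows "{x. s < C x} \<noteq> {}"
proof -
  have "eventually (\<lambda>x. s < C x) at_top" by (rule order_tendstoD(1)[OF cdf_lim_at_top_prob assms])
  then show ?thesis using eventually_happens'[OF trivial_limit_at_top_linorder] by blast
qed

lemma upper_I_bdd:
  assumes "0 < s" shows "bdd_below {x. s < C x}"
proof -
  have "eventually (\<lambda>x. C x < s) at_bot" by (rule order_tendstoD(2)[OF cdf_lim_at_bot assms])
  then obtain y where y: "C y < s" using eventually_happens'[OF trivial_limit_at_bot_linorder] by blast
  show ?thesis
  proof (rule bdd_belowI[of _ y])
    fix x assume "x \<in> {x. s < C x}"
    then have "C y < C x" using y by simp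
    then show "y \<le> x" using cdf_nondecreasing[of x y] by (cases "y \<le> x") auto
  qed
qed

text \<open>Boundedness from below is a premise because at \<open>s = 0\<close> it depends on the
  distribution.\<close>

lemma upper_I_mono_le:
  assumes "s \<le> t" "t < 1" "bdd_below {x. s < C x}"
  shows "upper_I s \<le> upper_I t"
  unfolding upper_I_def by (rule cInf_superset_mono[OF upper_I_nonempty[OF assms(2)] assms(3)]) (use assms in auto)

lemma upper_I_mono: "mono_on {0<..<1} upper_I"
proof (rule mono_onI)
  fix s t :: real assume "s \<in> {0<..<1}" "t \<in> {0<..<1}" "s \<le> t"
  then show "upper_I s \<le> upper_I t" by (intro upper_I_mono_le upper_I_bdd) auto
qed

lemma I_le_upper_I:
  assumes "0 < s" "s < 1" shows "I s \<le> upper_I s"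
  unfolding upper_I_def
proof (rule cInf_greatest[OF upper_I_nonempty[OF assms(2)]])
  fix x assume "x \<in> {x. s < C x}"
  then show "I s \<le> x" using pseudoinverse[OF assms, of x] by simp
qed

lemma upper_I_le_I:
  assumes "0 < s" "s < t" "t < 1" shows "upper_I s \<le> I t"
  unfolding upper_I_def
proof (rule cInf_lower[OF _ upper_I_bdd[OF assms(1)]])
  have "t \<le> C (I t)" using pseudoinverse[of t "I t"] assms by auto
  then show "I t \<in> {x. s < C x}" using assms by simp
qed

text \<open>\<open>upper_I s\<close> lies between \<open>I s\<close> and every \<open>I t\<close>
  with \<open>t > s\<close>, so the two quantile functions agree wherever \<open>I\<close> is
  continuous.\<close>

lemma upper_I_AE: "AE s in unit_lborel. upper_I s = I s"
proof -
  have eq: "upper_I s = I s" if s: "0 < s" "s < 1" "isCont I s" for s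
  proof (rule antisym[OF _ I_le_upper_I[OF s(1,2)]])
    have "(I \<longlongrightarrow> I s) (at_right s)"
      using s(3) by (auto simp: isCont_def intro: tendsto_within_subset)
    moreover have "eventually (\<lambda>t. upper_I s \<le> I t) (at_right s)"
    proof -
      have "eventually (\<lambda>t. t \<in> {s<..<1}) (at_right s)" by (rule eventually_at_right_real[OF s(2)])
      then show ?thesis by eventually_elim (use upper_I_le_I[of s] s in auto)
    qed
    ultimately show "upper_I s \<le> I s" by (rule tendsto_lowerbound) simp
  qed
  have "AE s in unit_lborel. s \<notin> {a \<in> {0<..<1}. \<not> isCont I a}"
    by (rule unit_AE_countable[OF mono_on_ctble_discont_open[OF _ mono_I]]) simp
  moreover have "AE s in unit_lborel. s \<in> {0<..<1}"
    by (metis AE_space unit_space)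
  ultimately show ?thesis by eventually_elim (use eq in auto)
qed

text \<open>The second moment of \<open>M\<close> passes to \<open>I\<close> by the image measure
  and then to \<open>upper_I\<close> by almost sure equality.\<close>

lemma upper_I_square_integrable:
  assumes "integrable M (\<lambda>x. x\<^sup>2)"
  shows "integrable unit_lborel (\<lambda>s. (upper_I s)\<^sup>2)"
proof -
  have Im[measurable]: "I \<in> borel_measurable unit_lborel" by (rule measurable_unit_mono[OF mono_I])
  have Um[measurable]: "upper_I \<in> borel_measurable unit_lborel" by (rule measurable_unit_mono[OF upper_I_mono])
  have "integrable (distr unit_lborel borel I) (\<lambda>x. x\<^sup>2)" using assms by (simp add: distr_I_eq_M)
  then have "integrable unit_lborel (\<lambda>s. (I s)\<^sup>2)" by (subst (asm) integrable_distr_eq) auto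
  also have "?this \<longleftrightarrow> ?thesis"
    by (rule integrable_cong_AE) (use upper_I_AE in auto)
  finally show ?thesis .
qed

end

section \<open>Quantile functions of random variables\<close>

lemma upper_quantile_eq_upper_I:
  assumes "prob_space M" "X \<in> borel_measurable M"
  shows "cdf_distribution (distr M borel X)"
    and "upper_quantile M X = cdf_distribution.upper_I (distr M borel X)"
    and "cdf (distr M borel X) x = measure M {\<omega> \<in> space M. X \<omega> \<le> x}"
proof -
  interpret prob_space M by fact
  interpret D: prob_space "distr M borel X" by (rule prob_space_distr[OF assms(2)])
  show 1: "cdf_distribution (distr M borel X)"
    by (intro cdf_distribution.intro real_distribution.intro real_distribution_axioms.intro) (auto intro: D.prob_space_axioms)
  have 2: "cdf (distr M borel X) x = measure M {\<omega> \<in> space M. X \<omega> \<le> x}" for x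
    unfolding cdf_def by (subst measure_distr[OF assms(2)]) (auto intro!: arg_cong[where f = "measure M"])
  show "upper_quantile M X = cdf_distribution.upper_I (distr M borel X)"
    by (rule ext) (simp add: upper_quantile_def cdf_distribution.upper_I_def[OF 1] 2)
  show "cdf (distr M borel X) x = measure M {\<omega> \<in> space M. X \<omega> \<le> x}" by (rule 2)
qed

lemma (in prob_space) upper_quantile_square_integrable:
  assumes X: "X \<in> borel_measurable M" and "integrable M (\<lambda>\<omega>. (X \<omega>)\<^sup>2)"
  shows "mono_on {0<..<1} (upper_quantile M X)"
    and "integrable unit_lborel (\<lambda>s. (upper_quantile M X s)\<^sup>2)"
proof -
  note eq = upper_quantile_eq_upper_I[OF prob_space_axioms X]
  interpret D: cdf_distribution "distr M borel X" by (rule eq(1))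
  show "mono_on {0<..<1} (upper_quantile M X)" unfolding eq(2) by (rule D.upper_I_mono)
  show "integrable unit_lborel (\<lambda>s. (upper_quantile M X s)\<^sup>2)"
    unfolding eq(2) by (rule D.upper_I_square_integrable) (subst integrable_distr_eq[OF X], simp, fact)
qed

lemma (in prob_space) upper_quantile_nonneg:
  assumes X: "X \<in> borel_measurable M" and pos: "AE \<omega> in M. 0 < X \<omega>" and s: "0 < s" "s < 1"
  shows "0 \<le> upper_quantile M X s"
proof -
  note eq = upper_quantile_eq_upper_I[OF prob_space_axioms X]
  interpret D: cdf_distribution "distr M borel X" by (rule eq(1))
  have "0 \<le> x" if "s < cdf (distr M borel X) x" for x
  proof (rule ccontr)
    assume x: "\<not> 0 \<le> x"
    have "AE \<omega> in M. \<not> X \<omega> \<le> x" using pos by eventually_elim (use x in auto)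
    then have "measure M {\<omega> \<in> space M. X \<omega> \<le> x} = 0" using X by (subst prob_eq_0) auto
    then show False using that s by (simp add: eq(3))
  qed
  then show ?thesis
    unfolding eq(2) D.upper_I_def by (intro cInf_greatest D.upper_I_nonempty) (use s in auto)
qed

text \<open>The point \<open>s = 0\<close> is included: the distribution function vanishes below
  \<open>- C\<close>, so the infimum is over a set bounded below even there.\<close>

lemma (in prob_space) upper_quantile_bounded:
  assumes X: "X \<in> borel_measurable M" and bound: "AE \<omega> in M. \<bar>X \<omega>\<bar> \<le> C"
  shows "mono_on {0..<1} (upper_quantile M X)"
    and "0 \<le> s \<Longrightarrow> s < 1 \<Longrightarrow> \<bar>upper_quantile M X s\<bar> \<le> C"
proof -
  note eq = upper_quantile_eq_upper_I[OF prob_space_axioms X]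
  interpret D: cdf_distribution "distr M borel X" by (rule eq(1))
  have ge: "- C \<le> x" if "0 \<le> s" "s < cdf (distr M borel X) x" for x s
  proof (rule ccontr)
    assume x: "\<not> - C \<le> x"
    have "AE \<omega> in M. \<not> X \<omega> \<le> x" using bound by eventually_elim (use x in auto)
    then have "measure M {\<omega> \<in> space M. X \<omega> \<le> x} = 0" using X by (subst prob_eq_0) auto
    then show False using that by (simp add: eq(3))
  qed
  have bdd: "bdd_below {x. s < cdf (distr M borel X) x}" if "0 \<le> s" for s
    by (rule bdd_belowI[of _ "- C"]) (use ge that in auto)
  have "AE \<omega> in M. X \<omega> \<le> C" using bound by eventually_elim auto
  then have "measure M {\<omega> \<in> space M. X \<omega> \<le> C} = 1" using X by (subst prob_eq_1) auto
  then have C1: "cdf (distr M borel X) C = 1" by (simp add: eq(3))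
  show "mono_on {0..<1} (upper_quantile M X)"
    unfolding eq(2)
  proof (rule mono_onI)
    fix s t :: real assume "s \<in> {0..<1}" "t \<in> {0..<1}" "s \<le> t"
    then show "D.upper_I s \<le> D.upper_I t" by (intro D.upper_I_mono_le bdd) auto
  qed
  assume s: "0 \<le> s" "s < 1"
  have "- C \<le> D.upper_I s"
    unfolding D.upper_I_def by (intro cInf_greatest D.upper_I_nonempty) (use s ge in auto)
  moreover have "D.upper_I s \<le> C"
    unfolding D.upper_I_def by (rule cInf_lower[OF _ bdd[OF s(1)]]) (use s C1 in auto)
  ultimately show "\<bar>upper_quantile M X s\<bar> \<le> C" unfolding eq(2) by (simp add: abs_le_iff)
qed

theorem theorem5p1:
  fixes M :: "'a measure" and \<rho> X0 :: "'a \<Rightarrow> real" and \<beta> lam :: real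
  assumes "prob_space M" and "complete_measure M" and "nonatomic M"
    and "\<rho> \<in> borel_measurable M" and "integrable M (\<lambda>x. (\<rho> x)\<^sup>2)"
    and "AE x in M. \<rho> x > 0"
    and "(LINT x|M. (\<rho> x - (LINT y|M. \<rho> y))\<^sup>2) > 0"
    and "X0 \<in> borel_measurable M" and "\<exists>C. AE x in M. \<bar>X0 x\<bar> \<le> C"
    and "lam > 0"
  shows
   "let Qrho = upper_quantile M \<rho>; Q0 = upper_quantile M X0;
        D = (\<lambda>w. dual_obj Qrho Q0 w \<beta> lam);
        Hh = concave_envelope (Hfun Qrho Q0 \<beta> lam)
    in \<exists>w\<in>Wicx. (\<forall>v\<in>Wicx. D v \<le> D w)
         \<and> (\<forall>v\<in>Wicx. (\<forall>u\<in>Wicx. D u \<le> D v) \<longrightarrow> (\<forall>s\<in>{0..1}. v s = w s))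
         \<and> (\<forall>s\<in>{0..<1}. \<exists>d. (Hh has_real_derivative d) (at_right s)
                            \<and> (w has_real_derivative max 0 (- d)) (at_right s))
         \<and> (\<exists>B. \<forall>s\<in>{0..<1}. \<bar>rderiv w s\<bar> \<le> B)
         \<and> w \<in> Wc2"
proof -
  interpret prob_space M by fact
  obtain C where C: "AE x in M. \<bar>X0 x\<bar> \<le> C" using assms(9) by auto
  interpret S: sdf_dual "upper_quantile M \<rho>" "upper_quantile M X0" \<beta> lam C
  proof
    show "mono_on {0<..<1} (upper_quantile M \<rho>)" "integrable unit_lborel (\<lambda>s. (upper_quantile M \<rho> s)\<^sup>2)"
      by (rule upper_quantile_square_integrable[OF assms(4,5)])+
    show "mono_on {0..<1} (upper_quantile M X0)" by (rule upper_quantile_bounded(1)[OF assms(8) C])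
    fix s :: real
    show "0 < s \<Longrightarrow> s < 1 \<Longrightarrow> 0 \<le> upper_quantile M \<rho> s" by (rule upper_quantile_nonneg[OF assms(4,6)])
    show "0 \<le> s \<Longrightarrow> s < 1 \<Longrightarrow> \<bar>upper_quantile M X0 s\<bar> \<le> C" by (rule upper_quantile_bounded(2)[OF assms(8) C])
  qed (rule assms(10))
  show ?thesis
    unfolding Let_def
  proof (intro bexI[OF _ S.W_Wicx] conjI ballI impI)
    fix v assume v: "v \<in> Wicx"
    show "dual_obj (upper_quantile M \<rho>) (upper_quantile M X0) v \<beta> lam
        \<le> dual_obj (upper_quantile M \<rho>) (upper_quantile M X0) S.W \<beta> lam"
      by (rule S.dual_obj_le_W[OF v])
    fix s :: real
    assume "\<forall>u\<in>Wicx. dual_obj (upper_quantile M \<rho>) (upper_quantile M X0) u \<beta> lam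
        \<le> dual_obj (upper_quantile M \<rho>) (upper_quantile M X0) v \<beta> lam" "s \<in> {0..1}"
    then show "v s = S.W s" by (intro S.W_unique[OF v]) auto
  qed (fact S.envelope_W_right_deriv S.rderiv_W_bounded S.W_Wc2)+
qed

end
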